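(* Let $A$ be an algebra in a semidegenerate congruence modular variety such that $K(A)$ is closed under the commutator, and assume the reticulation of $A$ preserves the Boolean center. Then for every $\alpha\in B(Con(A))$ the set $D_A(\alpha)$ is clopen in $Spec(A)$, and the map $B(Con(A))\rightarrow Clop(Spec(A))$, $\alpha\mapsto D_A(\alpha)$, is a Boolean isomorphism.
   Context: $\mathcal{V}$ is a congruence modular, semidegenerate variety (no nontrivial algebra has a one-element subalgebra; equivalently $\nabla_A$ is compact) of finite signature; $A\in\mathcal{V}$. $Con(A)$ is the congruence lattice with bounds $\Delta_A,\nabla_A$, $[\cdot,\cdot]$ the Freese–McKenzie commutator, $K(A)$ the compact congruences. $[\alpha,\alpha]^0=\alpha$, $[\alpha,\alpha]^{n+1}=[[\alpha,\alpha]^n,[\alpha,\alpha]^n]$. A congruence $\phi\neq\nabla_A$ is prime if $[\alpha,\beta]\subseteq\phi$ implies $\alpha\subseteq\phi$ or $\beta\subseteq\phi$; $Spec(A)$ is the set of primes; $\rho(\theta)$ is the intersection of primes containing $\theta$; $V_A(\theta)=\{\phi\in Spec(A):\theta\subseteq\phi\}$, $D_A(\theta)=Spec(A)\setminus V_A(\theta)$, and the sets $D_A(\theta)$, $\theta\in Con(A)$, are the open sets of the topology on $Spec(A)$. $Clop(X)$ is the Boolean algebra of clopen subsets of $X$. $B(Con(A))$ is the Boolean algebra of complemented elements of $Con(A)$. The reticulation $L(A)=K(A)/{\equiv}$ ($\alpha\equiv\beta$ iff $\rho(\alpha)=\rho(\beta)$) is a bounded distributive lattice with canonical map $\lambda_A:K(A)\to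 L(A)$; $\lambda_A$ maps $B(Con(A))$ injectively into the Boolean center $B(L(A))$ (complemented elements of $L(A)$). The reticulation of $A$ preserves the Boolean center if $\lambda_A|_{B(Con(A))}:B(Con(A))\to B(L(A))$ is surjective. *)

theory Defs
  imports Main
begin

datatype 'f trm = Var nat | App 'f "'f trm list"

record ('a, 'f) alg =
  car :: "'a set"
  opr :: "'f \<Rightarrow> 'a list \<Rightarrow> 'a"

fun wf_trm :: "'f set \<Rightarrow> ('f \<Rightarrow> nat) \<Rightarrow> 'f trm \<Rightarrow> bool" where
  "wf_trm F ar (Var n) = True"
| "wf_trm F ar (App f ts) = (f \<in> F \<and> length ts = ar f \<and> (\<forall>t\<in>set ts. wf_trm F ar t))"

fun eval :: "('a, 'f) alg \<Rightarrow> (nat \<Rightarrow> 'a) \<Rightarrow> 'f trm \<Rightarrow> 'a" where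
  "eval A \<rho> (Var n) = \<rho> n"
| "eval A \<rho> (App f ts) = opr A f (map (eval A \<rho>) ts)"

definition is_alg :: "'f set \<Rightarrow> ('f \<Rightarrow> nat) \<Rightarrow> ('a, 'f) alg \<Rightarrow> bool" where
  "is_alg F ar A \<longleftrightarrow> car A \<noteq> {} \<and>
     (\<forall>f\<in>F. \<forall>xs. length xs = ar f \<and> set xs \<subseteq> car A \<longrightarrow> opr A f xs \<in> car A)"

definition eqns :: "'f set \<Rightarrow> ('f \<Rightarrow> nat) \<Rightarrow> ('f trm \<times> 'f trm) set \<Rightarrow> bool" where
  "eqns F ar Eq \<longleftrightarrow> (\<forall>(s, t)\<in>Eq. wf_trm F ar s \<and> wf_trm F ar t)"

definition in_var :: "'f set \<Rightarrow> ('f \<Rightarrow> nat) \<Rightarrow> ('f trm \<times> 'f trm) set \<Rightarrow> ('a, 'f) alg \<Rightarrow> bool" where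
  "in_var F ar Eq A \<longleftrightarrow> is_alg F ar A \<and>
     (\<forall>(s, t)\<in>Eq. \<forall>\<rho>. (\<forall>n. \<rho> n \<in> car A) \<longrightarrow> eval A \<rho> s = eval A \<rho> t)"

definition Con :: "'f set \<Rightarrow> ('f \<Rightarrow> nat) \<Rightarrow> ('a, 'f) alg \<Rightarrow> ('a \<times> 'a) set set" where
  "Con F ar A = {\<theta>. \<theta> \<subseteq> car A \<times> car A \<and> equiv (car A) \<theta> \<and>
     (\<forall>f\<in>F. \<forall>xs ys. length xs = ar f \<and> list_all2 (\<lambda>x y. (x, y) \<in> \<theta>) xs ys
        \<longrightarrow> (opr A f xs, opr A f ys) \<in> \<theta>)}"

definition Delta :: "('a, 'f) alg \<Rightarrow> ('a \<times> 'a) set" where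
  "Delta A = Id_on (car A)"

definition Nabla :: "('a, 'f) alg \<Rightarrow> ('a \<times> 'a) set" where
  "Nabla A = car A \<times> car A"

definition cg :: "'f set \<Rightarrow> ('f \<Rightarrow> nat) \<Rightarrow> ('a, 'f) alg \<Rightarrow> ('a \<times> 'a) set \<Rightarrow> ('a \<times> 'a) set" where
  "cg F ar A X = \<Inter>{\<theta> \<in> Con F ar A. X \<subseteq> \<theta>}"

definition cjoin :: "'f set \<Rightarrow> ('f \<Rightarrow> nat) \<Rightarrow> ('a, 'f) alg \<Rightarrow> ('a \<times> 'a) set \<Rightarrow> ('a \<times> 'a) set \<Rightarrow> ('a \<times> 'a) set" where
  "cjoin F ar A \<alpha> \<beta> = cg F ar A (\<alpha> \<union> \<beta>)"

definition Kc :: "'f set \<Rightarrow> ('f \<Rightarrow> nat) \<Rightarrow> ('a, 'f) alg \<Rightarrow> ('a \<times> 'a) set set" where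
  "Kc F ar A = {\<alpha> \<in> Con F ar A. \<forall>S \<subseteq> Con F ar A. \<alpha> \<subseteq> cg F ar A (\<Union>S) \<longrightarrow>
      (\<exists>T \<subseteq> S. finite T \<and> \<alpha> \<subseteq> cg F ar A (\<Union>T))}"

definition con_modular :: "'f set \<Rightarrow> ('f \<Rightarrow> nat) \<Rightarrow> ('a, 'f) alg \<Rightarrow> bool" where
  "con_modular F ar A \<longleftrightarrow> (\<forall>\<alpha>\<in>Con F ar A. \<forall>\<beta>\<in>Con F ar A. \<forall>\<gamma>\<in>Con F ar A.
     \<alpha> \<subseteq> \<gamma> \<longrightarrow> cjoin F ar A \<alpha> (\<beta> \<inter> \<gamma>) = cjoin F ar A \<alpha> \<beta> \<inter> \<gamma>)"

text \<open>Congruence modularity / semidegeneracy of the variety, quantified over all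
  members of the variety whose carrier lives in the type 'b.\<close>
definition cong_modular_on :: "'f set \<Rightarrow> ('f \<Rightarrow> nat) \<Rightarrow> ('f trm \<times> 'f trm) set \<Rightarrow> 'b itself \<Rightarrow> bool" where
  "cong_modular_on F ar Eq T \<longleftrightarrow> (\<forall>B :: ('b, 'f) alg. in_var F ar Eq B \<longrightarrow> con_modular F ar B)"

definition semidegenerate_on :: "'f set \<Rightarrow> ('f \<Rightarrow> nat) \<Rightarrow> ('f trm \<times> 'f trm) set \<Rightarrow> 'b itself \<Rightarrow> bool" where
  "semidegenerate_on F ar Eq T \<longleftrightarrow> (\<forall>B :: ('b, 'f) alg. in_var F ar Eq B \<longrightarrow>
     (\<exists>x\<in>car B. \<exists>y\<in>car B. x \<noteq> y) \<longrightarrow>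
     \<not> (\<exists>e\<in>car B. \<forall>f\<in>F. opr B f (replicate (ar f) e) = e))"

definition mix :: "nat set \<Rightarrow> (nat \<Rightarrow> 'a) \<Rightarrow> (nat \<Rightarrow> 'a) \<Rightarrow> nat \<Rightarrow> 'a" where
  "mix X a c = (\<lambda>i. if i \<in> X then a i else c i)"

definition centralizes :: "'f set \<Rightarrow> ('f \<Rightarrow> nat) \<Rightarrow> ('a, 'f) alg \<Rightarrow>
    ('a \<times> 'a) set \<Rightarrow> ('a \<times> 'a) set \<Rightarrow> ('a \<times> 'a) set \<Rightarrow> bool" where
  "centralizes F ar A \<alpha> \<beta> \<delta> \<longleftrightarrow> (\<forall>t X a b c d. wf_trm F ar t \<and>
     (\<forall>i. (a i, b i) \<in> \<alpha>) \<and> (\<forall>i. (c i, d i) \<in> \<beta>) \<and>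
     (eval A (mix X a c) t, eval A (mix X a d) t) \<in> \<delta> \<longrightarrow>
     (eval A (mix X b c) t, eval A (mix X b d) t) \<in> \<delta>)"

definition comm :: "'f set \<Rightarrow> ('f \<Rightarrow> nat) \<Rightarrow> ('a, 'f) alg \<Rightarrow>
    ('a \<times> 'a) set \<Rightarrow> ('a \<times> 'a) set \<Rightarrow> ('a \<times> 'a) set" where
  "comm F ar A \<alpha> \<beta> = \<Inter>{\<delta> \<in> Con F ar A. centralizes F ar A \<alpha> \<beta> \<delta>}"

definition is_prime :: "'f set \<Rightarrow> ('f \<Rightarrow> nat) \<Rightarrow> ('a, 'f) alg \<Rightarrow> ('a \<times> 'a) set \<Rightarrow> bool" where
  "is_prime F ar A \<phi> \<longleftrightarrow> \<phi> \<in> Con F ar A \<and> \<phi> \<noteq> Nabla A \<and>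
     (\<forall>\<alpha>\<in>Con F ar A. \<forall>\<beta>\<in>Con F ar A. comm F ar A \<alpha> \<beta> \<subseteq> \<phi> \<longrightarrow> \<alpha> \<subseteq> \<phi> \<or> \<beta> \<subseteq> \<phi>)"

definition Spec :: "'f set \<Rightarrow> ('f \<Rightarrow> nat) \<Rightarrow> ('a, 'f) alg \<Rightarrow> ('a \<times> 'a) set set" where
  "Spec F ar A = {\<phi>. is_prime F ar A \<phi>}"

definition VA :: "'f set \<Rightarrow> ('f \<Rightarrow> nat) \<Rightarrow> ('a, 'f) alg \<Rightarrow> ('a \<times> 'a) set \<Rightarrow> ('a \<times> 'a) set set" where
  "VA F ar A \<theta> = {\<phi> \<in> Spec F ar A. \<theta> \<subseteq> \<phi>}"

definition DA :: "'f set \<Rightarrow> ('f \<Rightarrow> nat) \<Rightarrow> ('a, 'f) alg \<Rightarrow> ('a \<times> 'a) set \<Rightarrow> ('a \<times> 'a) set set" where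
  "DA F ar A \<theta> = Spec F ar A - VA F ar A \<theta>"

definition spec_open :: "'f set \<Rightarrow> ('f \<Rightarrow> nat) \<Rightarrow> ('a, 'f) alg \<Rightarrow> ('a \<times> 'a) set set \<Rightarrow> bool" where
  "spec_open F ar A U \<longleftrightarrow> (\<exists>\<theta>\<in>Con F ar A. U = DA F ar A \<theta>)"

definition Clop :: "'f set \<Rightarrow> ('f \<Rightarrow> nat) \<Rightarrow> ('a, 'f) alg \<Rightarrow> ('a \<times> 'a) set set set" where
  "Clop F ar A = {U. U \<subseteq> Spec F ar A \<and> spec_open F ar A U \<and> spec_open F ar A (Spec F ar A - U)}"

definition BCon :: "'f set \<Rightarrow> ('f \<Rightarrow> nat) \<Rightarrow> ('a, 'f) alg \<Rightarrow> ('a \<times> 'a) set set" where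
  "BCon F ar A = {\<alpha> \<in> Con F ar A. \<exists>\<beta>\<in>Con F ar A.
     \<alpha> \<inter> \<beta> = Delta A \<and> cjoin F ar A \<alpha> \<beta> = Nabla A}"

definition rho :: "'f set \<Rightarrow> ('f \<Rightarrow> nat) \<Rightarrow> ('a, 'f) alg \<Rightarrow> ('a \<times> 'a) set \<Rightarrow> ('a \<times> 'a) set" where
  "rho F ar A \<theta> = Nabla A \<inter> \<Inter>(VA F ar A \<theta>)"

definition lam :: "'f set \<Rightarrow> ('f \<Rightarrow> nat) \<Rightarrow> ('a, 'f) alg \<Rightarrow> ('a \<times> 'a) set \<Rightarrow> ('a \<times> 'a) set set" where
  "lam F ar A \<alpha> = {\<beta> \<in> Kc F ar A. rho F ar A \<beta> = rho F ar A \<alpha>}"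

definition Ret :: "'f set \<Rightarrow> ('f \<Rightarrow> nat) \<Rightarrow> ('a, 'f) alg \<Rightarrow> ('a \<times> 'a) set set set" where
  "Ret F ar A = lam F ar A ` Kc F ar A"

definition ret_le :: "'f set \<Rightarrow> ('f \<Rightarrow> nat) \<Rightarrow> ('a, 'f) alg \<Rightarrow>
    ('a \<times> 'a) set set \<Rightarrow> ('a \<times> 'a) set set \<Rightarrow> bool" where
  "ret_le F ar A x y \<longleftrightarrow> (\<exists>\<alpha>\<in>x. \<exists>\<beta>\<in>y. rho F ar A \<alpha> \<subseteq> rho F ar A \<beta>)"

text \<open>Complemented elements of the bounded lattice L(A) (meet = 0, join = 1,
  written via the lattice order; bounds are lambda(Delta), lambda(Nabla)).\<close>
definition BRet :: "'f set \<Rightarrow> ('f \<Rightarrow> nat) \<Rightarrow> ('a, 'f) alg \<Rightarrow> ('a \<times> 'a) set set set" where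
  "BRet F ar A = {x \<in> Ret F ar A. \<exists>y\<in>Ret F ar A.
     (\<forall>z\<in>Ret F ar A. ret_le F ar A z x \<and> ret_le F ar A z y \<longrightarrow> ret_le F ar A z (lam F ar A (Delta A))) \<and>
     (\<forall>z\<in>Ret F ar A. ret_le F ar A x z \<and> ret_le F ar A y z \<longrightarrow> ret_le F ar A (lam F ar A (Nabla A)) z)}"

definition preserves_bc :: "'f set \<Rightarrow> ('f \<Rightarrow> nat) \<Rightarrow> ('a, 'f) alg \<Rightarrow> bool" where
  "preserves_bc F ar A \<longleftrightarrow> BRet F ar A \<subseteq> lam F ar A ` BCon F ar A"

end

theory Submission
  imports Defs
begin

text \<open>The term condition \<open>C(\<alpha>, \<beta>; \<delta>)\<close> says that the diagonal pairs of \<open>\<alpha>\<close> lie in the largest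
  congruence of the subalgebra \<open>\<beta>\<close> of \<open>A \<times> A\<close> that saturates \<open>\<delta>\<close>. Hence it is closed under joins in
  \<open>\<alpha>\<close>, and, by the shifting lemma on \<open>\<beta>\<close>, upward closed in \<open>\<delta>\<close>. If it holds for \<open>\<alpha> = \<nabla>\<close>, then the
  quotient of \<open>\<beta>\<close> has a one-element subalgebra, so it is trivial and \<open>\<beta> \<subseteq> \<delta>\<close>. This replaces
  additivity and symmetry of the commutator and the identity \<open>[\<nabla>, \<theta>] = \<theta>\<close>: it shows that maximal
  congruences are prime, and that \<open>D(\<alpha>) \<subseteq> D(\<beta>)\<close> forces \<open>\<alpha> \<subseteq> \<beta>\<close> for complemented \<open>\<alpha>\<close>. For
  surjectivity, compactness of \<open>\<nabla>\<close> writes a clopen set and its complement as \<open>D(\<alpha>)\<close> and \<open>D(\<beta>)\<close> with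
  compact \<open>\<alpha>\<close>, \<open>\<beta>\<close>, so \<open>\<lambda>(\<alpha>)\<close> is complemented in the reticulation and lifts to \<open>B(Con(A))\<close>.\<close>

section \<open>Congruences\<close>

lemma ConI:
  assumes "\<theta> \<subseteq> car A \<times> car A"
    and "\<And>x. x \<in> car A \<Longrightarrow> (x, x) \<in> \<theta>"
    and "\<And>x y. (x, y) \<in> \<theta> \<Longrightarrow> (y, x) \<in> \<theta>"
    and "\<And>x y z. (x, y) \<in> \<theta> \<Longrightarrow> (y, z) \<in> \<theta> \<Longrightarrow> (x, z) \<in> \<theta>"
    and "\<And>f xs ys. f \<in> F \<Longrightarrow> length xs = ar f \<Longrightarrow> list_all2 (\<lambda>x y. (x, y) \<in> \<theta>) xs ys
           \<Longrightarrow> (opr A f xs, opr A f ys) \<in> \<theta>"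
  shows "\<theta> \<in> Con F ar A"
proof -
  have "equiv (car A) \<theta>"
    by (intro equivI refl_onI symI transI) (fact assms(1), fact assms(2), fact assms(3), fact assms(4))
  then show ?thesis unfolding Con_def using assms(1) by (simp add: assms(5))
qed

lemma Con_carD: "\<theta> \<in> Con F ar A \<Longrightarrow> (x, y) \<in> \<theta> \<Longrightarrow> x \<in> car A \<and> y \<in> car A"
  unfolding Con_def by auto

lemma Con_subset: "\<theta> \<in> Con F ar A \<Longrightarrow> \<theta> \<subseteq> Nabla A"
  unfolding Con_def Nabla_def by auto

lemma Con_refl: "\<theta> \<in> Con F ar A \<Longrightarrow> x \<in> car A \<Longrightarrow> (x, x) \<in> \<theta>"
  unfolding Con_def by (auto simp: equiv_def refl_on_def)

lemma Con_sym: "\<theta> \<in> Con F ar A \<Longrightarrow> (x, y) \<in> \<theta> \<Longrightarrow> (y, x) \<in> \<theta>"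
  unfolding Con_def by (auto simp: equiv_def dest: symD)

lemma Con_trans: "\<theta> \<in> Con F ar A \<Longrightarrow> (x, y) \<in> \<theta> \<Longrightarrow> (y, z) \<in> \<theta> \<Longrightarrow> (x, z) \<in> \<theta>"
  unfolding Con_def by (auto simp: equiv_def dest: transD)

lemma Con_compat:
  "\<theta> \<in> Con F ar A \<Longrightarrow> f \<in> F \<Longrightarrow> length xs = ar f \<Longrightarrow> list_all2 (\<lambda>x y. (x, y) \<in> \<theta>) xs ys
    \<Longrightarrow> (opr A f xs, opr A f ys) \<in> \<theta>"
  unfolding Con_def by blast

lemma is_alg_opr:
  "is_alg F ar A \<Longrightarrow> f \<in> F \<Longrightarrow> length xs = ar f \<Longrightarrow> set xs \<subseteq> car A \<Longrightarrow> opr A f xs \<in> car A"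
  unfolding is_alg_def by blast

lemma in_var_is_alg: "in_var F ar Eq A \<Longrightarrow> is_alg F ar A"
  unfolding in_var_def by blast

text \<open>Arguments are replaced one at a time from left to right, and the resulting pairs are
  chained by transitivity; the prefix \<open>us\<close> in the induction collects the arguments
  already replaced.\<close>

lemma Con_one_placeI:
  assumes alg: "is_alg F ar A"
    and sub: "\<theta> \<subseteq> car A \<times> car A"
    and refl: "\<And>x. x \<in> car A \<Longrightarrow> (x, x) \<in> \<theta>"
    and sym: "\<And>x y. (x, y) \<in> \<theta> \<Longrightarrow> (y, x) \<in> \<theta>"
    and trans: "\<And>x y z. (x, y) \<in> \<theta> \<Longrightarrow> (y, z) \<in> \<theta> \<Longrightarrow> (x, z) \<in> \<theta>"
    and one: "\<And>f us vs x y. f \<in> F \<Longrightarrow> Suc (length us + length vs) = ar f \<Longrightarrow> set us \<subseteq> car A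
        \<Longrightarrow> set vs \<subseteq> car A \<Longrightarrow> (x, y) \<in> \<theta>
        \<Longrightarrow> (opr A f (us @ x # vs), opr A f (us @ y # vs)) \<in> \<theta>"
  shows "\<theta> \<in> Con F ar A"
proof (rule ConI[OF sub refl sym trans])
  fix f xs ys
  assume f: "f \<in> F" and len: "length xs = ar f" and rel: "list_all2 (\<lambda>x y. (x, y) \<in> \<theta>) xs ys"
  have "length us + length xs = ar f \<Longrightarrow> set us \<subseteq> car A \<Longrightarrow>
      (opr A f (us @ xs), opr A f (us @ ys)) \<in> \<theta>" for us
    using rel
  proof (induction xs ys arbitrary: us rule: list_all2_induct)
    case Nil
    then show ?case using is_alg_opr[OF alg f] by (auto intro: refl)
  next
    case (Cons x xs y ys)
    have xs: "set xs \<subseteq> car A"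
      using Cons.hyps(2) sub by (fastforce simp: list_all2_conv_all_nth set_conv_nth)
    have y: "y \<in> car A" using Cons.hyps(1) sub by blast
    have "(opr A f (us @ x # xs), opr A f (us @ y # xs)) \<in> \<theta>"
      using one[OF f _ Cons.prems(2) xs Cons.hyps(1)] Cons.prems(1) by simp
    moreover have "(opr A f ((us @ [y]) @ xs), opr A f ((us @ [y]) @ ys)) \<in> \<theta>"
      by (rule Cons.IH) (use Cons.prems y in auto)
    ultimately show ?case using trans by simp
  qed
  from this[of "[]"] len show "(opr A f xs, opr A f ys) \<in> \<theta>" by simp
qed

lemma list_all2_related_set:
  assumes "\<theta> \<subseteq> C \<times> C" "list_all2 (\<lambda>x y. (x, y) \<in> \<theta>) xs ys"
  shows "set xs \<subseteq> C" "set ys \<subseteq> C"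
  using assms by (fastforce simp: list_all2_conv_all_nth set_conv_nth)+

section \<open>Homomorphisms and inverse images of congruences\<close>

definition is_hom :: "'f set \<Rightarrow> ('f \<Rightarrow> nat) \<Rightarrow> ('a, 'f) alg \<Rightarrow> ('b, 'f) alg \<Rightarrow> ('a \<Rightarrow> 'b) \<Rightarrow> bool" where
  "is_hom F ar A B g \<longleftrightarrow> g ` car A \<subseteq> car B \<and>
     (\<forall>f\<in>F. \<forall>xs. length xs = ar f \<and> set xs \<subseteq> car A \<longrightarrow> g (opr A f xs) = opr B f (map g xs))"

definition pull :: "('a, 'f) alg \<Rightarrow> ('a \<Rightarrow> 'b) \<Rightarrow> ('b \<times> 'b) set \<Rightarrow> ('a \<times> 'a) set" where
  "pull A g \<theta> = {(x, y). x \<in> car A \<and> y \<in> car A \<and> (g x, g y) \<in> \<theta>}"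

lemma pull_iff: "(x, y) \<in> pull A g \<theta> \<longleftrightarrow> x \<in> car A \<and> y \<in> car A \<and> (g x, g y) \<in> \<theta>"
  unfolding pull_def by simp

lemma pull_Con:
  assumes alg: "is_alg F ar A" and hom: "is_hom F ar A B g" and \<theta>: "\<theta> \<in> Con F ar B"
  shows "pull A g \<theta> \<in> Con F ar A"
proof (rule ConI)
  show "pull A g \<theta> \<subseteq> car A \<times> car A" unfolding pull_def by auto
next
  fix x assume "x \<in> car A"
  then show "(x, x) \<in> pull A g \<theta>"
    using hom Con_refl[OF \<theta>, of "g x"] by (auto simp: pull_iff is_hom_def)
next
  fix x y assume "(x, y) \<in> pull A g \<theta>"
  then show "(y, x) \<in> pull A g \<theta>" using Con_sym[OF \<theta>, of "g x" "g y"] by (simp add: pull_iff)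
next
  fix x y z assume "(x, y) \<in> pull A g \<theta>" "(y, z) \<in> pull A g \<theta>"
  then show "(x, z) \<in> pull A g \<theta>"
    using Con_trans[OF \<theta>, of "g x" "g y" "g z"] by (simp add: pull_iff)
next
  fix f xs ys
  assume f: "f \<in> F" and len: "length xs = ar f"
    and rel: "list_all2 (\<lambda>x y. (x, y) \<in> pull A g \<theta>) xs ys"
  have sub: "pull A g \<theta> \<subseteq> car A \<times> car A" unfolding pull_def by auto
  note sets = list_all2_related_set[OF sub rel]
  have len': "length ys = ar f" using rel len list_all2_lengthD by fastforce
  have "list_all2 (\<lambda>x y. (x, y) \<in> \<theta>) (map g xs) (map g ys)"
    using rel by (auto simp: list_all2_conv_all_nth pull_def)
  then have "(opr B f (map g xs), opr B f (map g ys)) \<in> \<theta>"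
    using Con_compat[OF \<theta> f] len by simp
  then show "(opr A f xs, opr A f ys) \<in> pull A g \<theta>"
    using hom f len len' sets is_alg_opr[OF alg f] unfolding is_hom_def pull_def by simp
qed

section \<open>Bounds, meets and directed unions of congruences\<close>

lemma Nabla_Con:
  assumes "is_alg F ar A" shows "Nabla A \<in> Con F ar A"
proof (rule ConI)
  fix f xs ys
  assume f: "f \<in> F" and len: "length xs = ar f"
    and rel: "list_all2 (\<lambda>x y. (x, y) \<in> Nabla A) xs ys"
  then show "(opr A f xs, opr A f ys) \<in> Nabla A"
    using list_all2_related_set[of "Nabla A" "car A" xs ys] is_alg_opr[OF assms f] list_all2_lengthD[OF rel]
    by (simp add: Nabla_def)
qed (auto simp: Nabla_def)

lemma Delta_Con:
  assumes "is_alg F ar A" shows "Delta A \<in> Con F ar A"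
  by (rule Con_one_placeI[OF assms]) (auto simp: Delta_def intro!: is_alg_opr[OF assms])

lemma Delta_subset: "\<theta> \<in> Con F ar A \<Longrightarrow> Delta A \<subseteq> \<theta>"
  by (auto simp: Delta_def intro: Con_refl)

lemma Inter_Con:
  assumes S: "S \<subseteq> Con F ar A" and ne: "S \<noteq> {}"
  shows "\<Inter>S \<in> Con F ar A"
proof (rule ConI)
  show "\<Inter>S \<subseteq> car A \<times> car A" using assms unfolding Con_def by blast
next
  fix x assume "x \<in> car A"
  then show "(x, x) \<in> \<Inter>S" using S Con_refl[of _ F ar A x] by blast
next
  fix x y assume "(x, y) \<in> \<Inter>S"
  then show "(y, x) \<in> \<Inter>S" using S Con_sym[of _ F ar A x y] by blast
next
  fix x y z assume "(x, y) \<in> \<Inter>S" "(y, z) \<in> \<Inter>S"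
  then show "(x, z) \<in> \<Inter>S" using S Con_trans[of _ F ar A x y z] by blast
next
  fix f xs ys
  assume f: "f \<in> F" "length xs = ar f" and rel: "list_all2 (\<lambda>x y. (x, y) \<in> \<Inter>S) xs ys"
  have "(opr A f xs, opr A f ys) \<in> \<theta>" if \<theta>: "\<theta> \<in> S" for \<theta>
  proof -
    have "list_all2 (\<lambda>x y. (x, y) \<in> \<theta>) xs ys"
      using rel \<theta> by (auto simp: list_all2_conv_all_nth)
    then show ?thesis using Con_compat[of \<theta> F ar A f xs ys] S \<theta> f by blast
  qed
  then show "(opr A f xs, opr A f ys) \<in> \<Inter>S" by blast
qed

lemma Int_Con: "\<alpha> \<in> Con F ar A \<Longrightarrow> \<beta> \<in> Con F ar A \<Longrightarrow> \<alpha> \<inter> \<beta> \<in> Con F ar A"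
  using Inter_Con[of "{\<alpha>, \<beta>}" F ar A] by simp

text \<open>Operations are finitary, so the finitely many pairs of arguments lie together in one
  member of \<open>S\<close>.\<close>

lemma directed_Union_Con:
  assumes sub: "S \<subseteq> Con F ar A" and ne: "S \<noteq> {}"
    and dir: "\<And>\<alpha> \<beta>. \<alpha> \<in> S \<Longrightarrow> \<beta> \<in> S \<Longrightarrow> \<exists>\<gamma>\<in>S. \<alpha> \<union> \<beta> \<subseteq> \<gamma>"
  shows "\<Union>S \<in> Con F ar A"
proof (rule ConI)
  show "\<Union>S \<subseteq> car A \<times> car A" using sub unfolding Con_def by blast
next
  fix x assume "x \<in> car A"
  then show "(x, x) \<in> \<Union>S" using sub ne Con_refl[of _ F ar A x] by blast
next
  fix x y assume "(x, y) \<in> \<Union>S"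
  then show "(y, x) \<in> \<Union>S" using sub Con_sym[of _ F ar A x y] by blast
next
  fix x y z assume "(x, y) \<in> \<Union>S" "(y, z) \<in> \<Union>S"
  then obtain \<alpha> \<beta> where "\<alpha> \<in> S" "\<beta> \<in> S" "(x, y) \<in> \<alpha>" "(y, z) \<in> \<beta>" by blast
  with dir[of \<alpha> \<beta>] obtain \<gamma> where "\<gamma> \<in> S" "(x, y) \<in> \<gamma>" "(y, z) \<in> \<gamma>" by blast
  then show "(x, z) \<in> \<Union>S" using sub Con_trans[of \<gamma> F ar A x y z] by blast
next
  fix f xs ys
  assume f: "f \<in> F" "length xs = ar f" and rel: "list_all2 (\<lambda>x y. (x, y) \<in> \<Union>S) xs ys"
  from rel have "\<exists>\<gamma>\<in>S. list_all2 (\<lambda>x y. (x, y) \<in> \<gamma>) xs ys"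
  proof (induction xs ys rule: list_all2_induct)
    case Nil
    then show ?case using ne by auto
  next
    case (Cons x xs y ys)
    then obtain \<alpha> \<beta> where \<alpha>: "\<alpha> \<in> S" "(x, y) \<in> \<alpha>"
      and \<beta>: "\<beta> \<in> S" "list_all2 (\<lambda>x y. (x, y) \<in> \<beta>) xs ys" by blast
    with dir[of \<alpha> \<beta>] obtain \<gamma> where \<gamma>: "\<gamma> \<in> S" "(x, y) \<in> \<gamma>" "\<beta> \<subseteq> \<gamma>" by blast
    have "list_all2 (\<lambda>x y. (x, y) \<in> \<gamma>) xs ys"
      using \<beta>(2) by (rule list_all2_mono) (use \<gamma>(3) in blast)
    then show ?case using \<gamma> by auto
  qed
  then obtain \<gamma> where "\<gamma> \<in> S" "list_all2 (\<lambda>x y. (x, y) \<in> \<gamma>) xs ys" by blast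
  then show "(opr A f xs, opr A f ys) \<in> \<Union>S"
    using Con_compat[of \<gamma> F ar A f xs ys] sub f by blast
qed

section \<open>Generated congruences, joins and compactness\<close>

lemma subset_cg: "X \<subseteq> cg F ar A X"
  unfolding cg_def by (rule Inter_greatest) simp

lemma cg_least: "\<theta> \<in> Con F ar A \<Longrightarrow> X \<subseteq> \<theta> \<Longrightarrow> cg F ar A X \<subseteq> \<theta>"
  unfolding cg_def by (rule Inter_lower) simp

lemma cg_mono: "X \<subseteq> Y \<Longrightarrow> cg F ar A X \<subseteq> cg F ar A Y"
  unfolding cg_def by (rule Inter_anti_mono) auto

text \<open>The hypothesis on \<open>X\<close> puts \<open>Nabla A\<close> into the intersected
  family; the empty family would have intersection \<open>UNIV\<close>.\<close>

lemma cg_Con: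
  assumes "is_alg F ar A" "X \<subseteq> Nabla A"
  shows "cg F ar A X \<in> Con F ar A"
  unfolding cg_def by (rule Inter_Con) (use Nabla_Con[OF assms(1)] assms(2) in auto)

lemma cjoin_Con:
  assumes "is_alg F ar A" "\<alpha> \<in> Con F ar A" "\<beta> \<in> Con F ar A"
  shows "cjoin F ar A \<alpha> \<beta> \<in> Con F ar A"
  unfolding cjoin_def
  by (rule cg_Con[OF assms(1) Un_least[OF Con_subset[OF assms(2)] Con_subset[OF assms(3)]]])

lemma cjoin_subset_iff:
  assumes "\<theta> \<in> Con F ar A"
  shows "cjoin F ar A \<alpha> \<beta> \<subseteq> \<theta> \<longleftrightarrow> \<alpha> \<subseteq> \<theta> \<and> \<beta> \<subseteq> \<theta>"
proof
  show "cjoin F ar A \<alpha> \<beta> \<subseteq> \<theta> \<Longrightarrow> \<alpha> \<subseteq> \<theta> \<and> \<beta> \<subseteq> \<theta>"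
    using subset_cg[of "\<alpha> \<union> \<beta>" F ar A] unfolding cjoin_def by (meson le_sup_iff order_trans)
  show "\<alpha> \<subseteq> \<theta> \<and> \<beta> \<subseteq> \<theta> \<Longrightarrow> cjoin F ar A \<alpha> \<beta> \<subseteq> \<theta>"
    using cg_least[OF assms, of "\<alpha> \<union> \<beta>"] by (simp add: cjoin_def)
qed

text \<open>\<open>cg\<close> is an algebraic closure operator: the congruences generated by finite
  subsets of \<open>X\<close> are directed, so their union is a congruence, and it contains
  \<open>X\<close>.\<close>

lemma cg_finite_subset:
  assumes alg: "is_alg F ar A" and X: "X \<subseteq> Nabla A" and G: "finite G" "G \<subseteq> cg F ar A X"
  obtains P where "finite P" "P \<subseteq> X" "G \<subseteq> cg F ar A P"
proof -
  let ?S = "cg F ar A ` {P. finite P \<and> P \<subseteq> X}"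
  have dir: "\<exists>\<gamma>\<in>?S. \<alpha> \<union> \<beta> \<subseteq> \<gamma>" if ab: "\<alpha> \<in> ?S" "\<beta> \<in> ?S" for \<alpha> \<beta>
  proof -
    obtain P where P: "finite P" "P \<subseteq> X" "\<alpha> = cg F ar A P" using ab(1) by auto
    obtain Q where Q: "finite Q" "Q \<subseteq> X" "\<beta> = cg F ar A Q" using ab(2) by auto
    have "cg F ar A (P \<union> Q) \<in> ?S" using P(1,2) Q(1,2) by simp
    moreover have "\<alpha> \<union> \<beta> \<subseteq> cg F ar A (P \<union> Q)" unfolding P(3) Q(3) by (intro Un_least cg_mono) auto
    ultimately show ?thesis by (rule rev_bexI)
  qed
  have "\<Union>?S \<in> Con F ar A"
    proof (rule directed_Union_Con[OF _ _ dir])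
    show "?S \<subseteq> Con F ar A" using cg_Con[OF alg] X by auto
  qed auto
  moreover have "X \<subseteq> \<Union>?S"
  proof
    fix p assume "p \<in> X"
    then show "p \<in> \<Union>?S" using subset_cg[of "{p}" F ar A] by (intro UnionI[of "cg F ar A {p}"]) auto
  qed
  ultimately have "G \<subseteq> \<Union>?S" using cg_least[of "\<Union>?S" F ar A X] G(2) by (meson order_trans)
  have "\<exists>P. finite P \<and> P \<subseteq> X \<and> G \<subseteq> cg F ar A P"
    using G(1) \<open>G \<subseteq> \<Union>?S\<close>
  proof (induction G rule: finite_induct)
    case empty
    then show ?case by blast
  next
    case (insert g G)
    then obtain P where P: "finite P" "P \<subseteq> X" "G \<subseteq> cg F ar A P" by auto
    obtain Q where Q: "finite Q" "Q \<subseteq> X" "g \<in> cg F ar A Q" using insert.prems by auto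
    have "insert g G \<subseteq> cg F ar A (P \<union> Q)"
      using P(3) Q(3) cg_mono[of P "P \<union> Q" F ar A] cg_mono[of Q "P \<union> Q" F ar A] by auto
    then show ?case using P Q by (intro exI[of _ "P \<union> Q"]) auto
  qed
  then show thesis using that by blast
qed

text \<open>The finitely many generators depend on finitely many pairs of \<open>\<Union>S\<close>,
  and these come from finitely many members of \<open>S\<close>.\<close>

lemma cg_finite_compact:
  assumes alg: "is_alg F ar A" and G: "finite G" "G \<subseteq> Nabla A"
  shows "cg F ar A G \<in> Kc F ar A"
proof -
  have "\<exists>T\<subseteq>S. finite T \<and> cg F ar A G \<subseteq> cg F ar A (\<Union>T)"
    if S: "S \<subseteq> Con F ar A" and le: "cg F ar A G \<subseteq> cg F ar A (\<Union>S)" for S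
  proof -
    have US: "\<Union>S \<subseteq> Nabla A" using S Con_subset by blast
    have "G \<subseteq> cg F ar A (\<Union>S)" using subset_cg[of G F ar A] le by (rule order_trans)
    from cg_finite_subset[OF alg US G(1) this]
    obtain P where P: "finite P" "P \<subseteq> \<Union>S" "G \<subseteq> cg F ar A P" .
    obtain T where T: "finite T" "T \<subseteq> S" "P \<subseteq> \<Union>T" using finite_subset_Union[OF P(1,2)] .
    have UT: "\<Union>T \<subseteq> Nabla A" using Union_mono[OF T(2)] US by (rule order_trans)
    have "cg F ar A G \<subseteq> cg F ar A (\<Union>T)"
      by (rule cg_least[OF cg_Con[OF alg UT] order_trans[OF P(3) cg_mono[OF T(3)]]])
    with T show ?thesis by (intro exI[of _ T]) simp
  qed
  then show ?thesis unfolding Kc_def using cg_Con[OF alg G(2)] by simp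
qed

text \<open>\<open>Delta A\<close> is generated by the empty set.\<close>

lemma Delta_compact: "is_alg F ar A \<Longrightarrow> Delta A \<in> Kc F ar A"
  using cg_finite_compact[of F ar A "{}"] cg_least[OF Delta_Con, of F ar A "{}"]
    Delta_subset[OF cg_Con, of F ar A "{}"] by force

section \<open>Terms and quotients\<close>

lemma eval_car:
  assumes "is_alg F ar A" "\<And>i. \<rho> i \<in> car A" "wf_trm F ar t"
  shows "eval A \<rho> t \<in> car A"
  using assms(3)
proof (induction t)
  case (App f ts)
  then show ?case using is_alg_opr[OF assms(1), of f "map (eval A \<rho>) ts"] by auto
qed (simp add: assms)

lemma eval_Con:
  assumes "\<theta> \<in> Con F ar A" "\<And>i. (\<rho> i, \<sigma> i) \<in> \<theta>" "wf_trm F ar t"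
  shows "(eval A \<rho> t, eval A \<sigma> t) \<in> \<theta>"
  using assms(3)
proof (induction t)
  case (App f ts)
  then show ?case
    using Con_compat[OF assms(1), of f "map (eval A \<rho>) ts" "map (eval A \<sigma>) ts"]
    by (auto simp: list_all2_conv_all_nth)
qed (simp add: assms)

text \<open>The quotient by the kernel of \<open>r\<close>, realised on the image of \<open>r\<close>; with an injective \<open>r\<close> it moves
  an algebra to another type, with a choice of representatives it is a genuine quotient.\<close>
definition qalg :: "('a, 'f) alg \<Rightarrow> ('a \<Rightarrow> 'b) \<Rightarrow> ('b, 'f) alg" where
  "qalg B r = \<lparr>car = r ` car B, opr = \<lambda>f xs. r (opr B f (map (inv_into (car B) r) xs))\<rparr>"

text \<open>\<open>inv_into\<close> may return a preimage other than the given argument, but the two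
  are related by the kernel of \<open>r\<close>, which is a congruence.\<close>

lemma qalg_opr:
  assumes ker: "{(x, y). x \<in> car B \<and> y \<in> car B \<and> r x = r y} \<in> Con F ar B"
    and f: "f \<in> F" "length xs = ar f" "set xs \<subseteq> car B"
  shows "opr (qalg B r) f (map r xs) = r (opr B f xs)"
proof -
  have "list_all2 (\<lambda>x y. (x, y) \<in> {(x, y). x \<in> car B \<and> y \<in> car B \<and> r x = r y})
      (map (inv_into (car B) r) (map r xs)) xs"
    using f(3) by (auto simp: list_all2_conv_all_nth inv_into_into f_inv_into_f subset_iff)
  from Con_compat[OF ker f(1) _ this] show ?thesis
    using f(2) by (simp add: qalg_def comp_def)
qed

text \<open>An assignment into the image lifts along \<open>r\<close> to \<open>B\<close>, where the
  equations hold, and \<open>r\<close> commutes with the evaluation of terms.\<close>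

lemma qalg_in_var:
  assumes eqs: "eqns F ar Eq" and B: "in_var F ar Eq B"
    and ker: "{(x, y). x \<in> car B \<and> y \<in> car B \<and> r x = r y} \<in> Con F ar B"
  shows "in_var F ar Eq (qalg B r)"
proof -
  have alg: "is_alg F ar B" using B by (rule in_var_is_alg)
  have ev: "eval (qalg B r) (\<lambda>i. r (\<rho> i)) t = r (eval B \<rho> t)"
    if "\<And>i. \<rho> i \<in> car B" "wf_trm F ar t" for \<rho> t
    using that(2)
  proof (induction t)
    case (App f ts)
    have "map (eval (qalg B r) (\<lambda>i. r (\<rho> i))) ts = map r (map (eval B \<rho>) ts)"
      using App by simp
    moreover have "opr (qalg B r) f (map r (map (eval B \<rho>) ts)) = r (opr B f (map (eval B \<rho>) ts))"
      by (rule qalg_opr[OF ker]) (use App.prems eval_car[OF alg that(1)] in auto)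
    ultimately show ?case by (simp only: eval.simps)
  qed simp
  have "is_alg F ar (qalg B r)"
    unfolding is_alg_def
  proof (intro conjI ballI allI impI)
    show "car (qalg B r) \<noteq> {}" using alg by (simp add: qalg_def is_alg_def)
  next
    fix f xs assume "f \<in> F" "length xs = ar f \<and> set xs \<subseteq> car (qalg B r)"
    then show "opr (qalg B r) f xs \<in> car (qalg B r)"
      by (auto simp: qalg_def intro!: imageI is_alg_opr[OF alg] inv_into_into)
  qed
  moreover have "eval (qalg B r) \<rho> s = eval (qalg B r) \<rho> t"
    if st: "(s, t) \<in> Eq" and \<rho>: "\<forall>n. \<rho> n \<in> car (qalg B r)" for s t \<rho>
  proof -
    define \<sigma> where "\<sigma> = (\<lambda>i. inv_into (car B) r (\<rho> i))"
    have \<sigma>: "\<sigma> i \<in> car B" "r (\<sigma> i) = \<rho> i" for i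
      using \<rho> by (simp_all add: \<sigma>_def qalg_def inv_into_into f_inv_into_f)
    have wf: "wf_trm F ar s" "wf_trm F ar t" using eqs st unfolding eqns_def by auto
    have "eval B \<sigma> s = eval B \<sigma> t" using B st \<sigma>(1) unfolding in_var_def by auto
    then show ?thesis using ev[OF \<sigma>(1) wf(1)] ev[OF \<sigma>(1) wf(2)] \<sigma>(2) by simp
  qed
  ultimately show ?thesis unfolding in_var_def by blast
qed

text \<open>Semidegeneracy is given for carriers in \<open>'b\<close>, so the quotient by \<theta>
  is realised there: \<open>r\<close> sends an element to the image under \<open>g\<close> of a
  representative of its block. By \<open>idem\<close>, \<open>r e\<close> forms a one-element
  subalgebra.\<close>

lemma semidegenerate_collapse:
  fixes g :: "'a \<Rightarrow> 'b" and B :: "('a, 'f) alg"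
  assumes sd: "semidegenerate_on F ar Eq TYPE('b)" and eqs: "eqns F ar Eq"
    and inj: "inj_on g (car B)" and B: "in_var F ar Eq B" and \<theta>: "\<theta> \<in> Con F ar B"
    and e: "e \<in> car B" and idem: "\<And>f. f \<in> F \<Longrightarrow> (opr B f (replicate (ar f) e), e) \<in> \<theta>"
  shows "\<theta> = Nabla B"
proof -
  \<comment> \<open>The predicate under \<open>SOME\<close> is the same for all elements of a block,
    so \<open>c\<close> is constant on blocks.\<close>
  define c where "c = (\<lambda>x. SOME y. (x, y) \<in> \<theta>)"
  define r where "r = g \<circ> c"
  have c: "(x, c x) \<in> \<theta>" if "x \<in> car B" for x
    unfolding c_def using Con_refl[OF \<theta> that] by (rule someI)
  have ccar: "c x \<in> car B" if "x \<in> car B" for x using Con_carD[OF \<theta> c[OF that]] by simp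
  have req: "r x = r y \<longleftrightarrow> (x, y) \<in> \<theta>" if xy: "x \<in> car B" "y \<in> car B" for x y
  proof
    assume "r x = r y"
    then have "c x = c y" using inj ccar xy by (simp add: r_def inj_on_eq_iff)
    then show "(x, y) \<in> \<theta>" using c[OF xy(1)] c[OF xy(2)] Con_sym[OF \<theta>] Con_trans[OF \<theta>] by metis
  next
    assume "(x, y) \<in> \<theta>"
    then have "(x, z) \<in> \<theta> \<longleftrightarrow> (y, z) \<in> \<theta>" for z using Con_sym[OF \<theta>] Con_trans[OF \<theta>] by metis
    then show "r x = r y" by (simp add: r_def c_def)
  qed
  have "{(x, y). x \<in> car B \<and> y \<in> car B \<and> r x = r y} = \<theta>"
    using req Con_carD[OF \<theta>] by auto
  then have ker: "{(x, y). x \<in> car B \<and> y \<in> car B \<and> r x = r y} \<in> Con F ar B" using \<theta> by simp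
  have "opr (qalg B r) f (replicate (ar f) (r e)) = r e" if f: "f \<in> F" for f
  proof -
    have "opr (qalg B r) f (map r (replicate (ar f) e)) = r (opr B f (replicate (ar f) e))"
      by (rule qalg_opr[OF ker f]) (use e in auto)
    then show ?thesis using idem[OF f] req Con_carD[OF \<theta> idem[OF f]] by simp
  qed
  moreover have "r e \<in> car (qalg B r)" using e by (simp add: qalg_def)
  ultimately have triv: "\<forall>x\<in>car (qalg B r). \<forall>y\<in>car (qalg B r). x = y"
    using sd qalg_in_var[OF eqs B ker] unfolding semidegenerate_on_def by blast
  have "(x, y) \<in> \<theta>" if "x \<in> car B" "y \<in> car B" for x y
  proof -
    have "r x \<in> car (qalg B r)" "r y \<in> car (qalg B r)" using that by (simp_all add: qalg_def)
    then have "r x = r y" using triv by blast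
    then show ?thesis using req[OF that] by blast
  qed
  then have "Nabla B \<subseteq> \<theta>" unfolding Nabla_def by (intro subrelI) (elim SigmaE2)
  then show ?thesis by (rule equalityI[OF Con_subset[OF \<theta>]])
qed

section \<open>Gumm's shifting lemma\<close>

definition shifting :: "'f set \<Rightarrow> ('f \<Rightarrow> nat) \<Rightarrow> ('a, 'f) alg \<Rightarrow> bool" where
  "shifting F ar B \<longleftrightarrow> (\<forall>\<alpha>\<in>Con F ar B. \<forall>\<beta>\<in>Con F ar B. \<forall>\<gamma>\<in>Con F ar B. \<forall>a b c d.
     \<alpha> \<inter> \<beta> \<subseteq> \<gamma> \<longrightarrow> (a, b) \<in> \<beta> \<longrightarrow> (c, d) \<in> \<beta> \<longrightarrow> (a, c) \<in> \<alpha> \<longrightarrow> (b, d) \<in> \<alpha> \<inter> \<gamma> \<longrightarrow> (a, c) \<in> \<gamma>)"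

text \<open>The path \<open>a\<close>, \<open>b\<close>, \<open>d\<close>, \<open>c\<close> puts
  \<open>(a, c)\<close> into the join of \<open>\<alpha> \<inter> \<gamma>\<close> and \<beta>. By
  the modular law for \<open>\<alpha> \<inter> \<gamma> \<subseteq> \<alpha>\<close>, the meet of
  this join with \<alpha> is the join of \<open>\<alpha> \<inter> \<gamma>\<close> and
  \<open>\<beta> \<inter> \<alpha>\<close>, both below \<gamma>.\<close>

lemma con_modular_shifting:
  assumes alg: "is_alg F ar B" and cm: "con_modular F ar B"
  shows "shifting F ar B"
  unfolding shifting_def
proof (intro ballI allI impI)
  fix \<alpha> \<beta> \<gamma> a b c d
  assume Con: "\<alpha> \<in> Con F ar B" "\<beta> \<in> Con F ar B" "\<gamma> \<in> Con F ar B"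
    and le: "\<alpha> \<inter> \<beta> \<subseteq> \<gamma>" and ab: "(a, b) \<in> \<beta>" and cd: "(c, d) \<in> \<beta>"
    and ac: "(a, c) \<in> \<alpha>" and bd: "(b, d) \<in> \<alpha> \<inter> \<gamma>"
  let ?J = "cjoin F ar B (\<alpha> \<inter> \<gamma>) \<beta>"
  have J: "?J \<in> Con F ar B" by (rule cjoin_Con[OF alg Int_Con[OF Con(1,3)] Con(2)])
  have sub: "\<alpha> \<inter> \<gamma> \<subseteq> ?J" "\<beta> \<subseteq> ?J" using cjoin_subset_iff[OF J, of "\<alpha> \<inter> \<gamma>" \<beta>] by simp_all
  have "(a, c) \<in> ?J"
    by (rule Con_trans[OF J subsetD[OF sub(2) ab]
          Con_trans[OF J subsetD[OF sub(1) bd] Con_sym[OF J subsetD[OF sub(2) cd]]]])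
  moreover have "cjoin F ar B (\<alpha> \<inter> \<gamma>) (\<beta> \<inter> \<alpha>) = ?J \<inter> \<alpha>"
    using cm[unfolded con_modular_def, rule_format, OF Int_Con[OF Con(1,3)] Con(2,1)] by blast
  moreover have "cjoin F ar B (\<alpha> \<inter> \<gamma>) (\<beta> \<inter> \<alpha>) \<subseteq> \<gamma>"
    unfolding cjoin_subset_iff[OF Con(3)] using le by blast
  ultimately show "(a, c) \<in> \<gamma>" using ac by blast
qed

text \<open>Modularity is given for carriers in \<open>'b\<close>, so \<open>B\<close> is copied
  along \<open>g\<close>; congruences of \<open>B\<close> are pulled back to the copy along the
  inverse of \<open>g\<close>, and shifting is read off there.\<close>

lemma cong_modular_on_shifting:
  fixes g :: "'a \<Rightarrow> 'b" and B :: "('a, 'f) alg"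
  assumes cm: "cong_modular_on F ar Eq TYPE('b)" and eqs: "eqns F ar Eq"
    and inj: "inj_on g (car B)" and B: "in_var F ar Eq B"
  shows "shifting F ar B"
proof -
  have alg: "is_alg F ar B" using B by (rule in_var_is_alg)
  have "{(x, y). x \<in> car B \<and> y \<in> car B \<and> g x = g y} = Delta B"
    using inj by (auto simp: Delta_def inj_on_eq_iff)
  then have ker: "{(x, y). x \<in> car B \<and> y \<in> car B \<and> g x = g y} \<in> Con F ar B"
    using Delta_Con[OF alg] by simp
  let ?Q = "qalg B g" and ?i = "inv_into (car B) g"
  have Q: "in_var F ar Eq ?Q" by (rule qalg_in_var[OF eqs B ker])
  have algQ: "is_alg F ar ?Q" using Q by (rule in_var_is_alg)
  have sQ: "shifting F ar ?Q"
    using con_modular_shifting[OF algQ] cm Q unfolding cong_modular_on_def by blast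
  have hom: "is_hom F ar ?Q B ?i"
    unfolding is_hom_def
  proof (intro conjI ballI allI impI)
    show "?i ` car ?Q \<subseteq> car B" by (auto simp: qalg_def inv_into_into)
  next
    fix f xs assume "f \<in> F" "length xs = ar f \<and> set xs \<subseteq> car ?Q"
    then have "opr B f (map ?i xs) \<in> car B"
      by (intro is_alg_opr[OF alg]) (auto simp: qalg_def inv_into_into)
    then show "?i (opr ?Q f xs) = opr B f (map ?i xs)"
      using inj by (simp add: qalg_def inv_into_f_f)
  qed
  have tr: "(g x, g y) \<in> pull ?Q ?i \<theta> \<longleftrightarrow> (x, y) \<in> \<theta>"
    if "\<theta> \<in> Con F ar B" "x \<in> car B" "y \<in> car B" for \<theta> x y
    using that inj by (auto simp: pull_iff qalg_def inv_into_f_f)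
  show ?thesis
    unfolding shifting_def
  proof (intro ballI allI impI)
    fix \<alpha> \<beta> \<gamma> a b c d
    assume Con: "\<alpha> \<in> Con F ar B" "\<beta> \<in> Con F ar B" "\<gamma> \<in> Con F ar B"
      and le: "\<alpha> \<inter> \<beta> \<subseteq> \<gamma>" and ab: "(a, b) \<in> \<beta>" and cd: "(c, d) \<in> \<beta>"
      and ac: "(a, c) \<in> \<alpha>" and bd: "(b, d) \<in> \<alpha> \<inter> \<gamma>"
    have car: "a \<in> car B" "b \<in> car B" "c \<in> car B" "d \<in> car B"
      using Con_carD[OF Con(2) ab] Con_carD[OF Con(2) cd] by auto
    have le': "pull ?Q ?i \<alpha> \<inter> pull ?Q ?i \<beta> \<subseteq> pull ?Q ?i \<gamma>" using le by (auto simp: pull_def)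
    have "(g a, g c) \<in> pull ?Q ?i \<gamma>"
      using sQ[unfolded shifting_def, rule_format, OF Con[THEN pull_Con[OF algQ hom]] le', of "g a" "g b" "g c" "g d"]
        tr car Con ab cd ac bd by blast
    then show "(a, c) \<in> \<gamma>" using tr car Con by blast
  qed
qed

text \<open>Algebras of related pairs live on \<open>'a \<times> 'a\<close>, whereas the variety is
  controlled on carriers in \<open>'a\<close> and \<open>nat\<close>. For finite \<open>'a\<close>
  the pairs embed into \<open>nat\<close>; for infinite \<open>'a\<close> they are equinumerous with
  \<open>'a\<close>.\<close>

lemma inj_prod_cases:
  obtains (self) g :: "'a \<times> 'a \<Rightarrow> 'a" where "inj g" | (nat) g :: "'a \<times> 'a \<Rightarrow> nat" where "inj g"
proof (cases "finite (UNIV :: 'a set)")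
  case True
  then have "finite (UNIV :: ('a \<times> 'a) set)" using finite_Prod_UNIV by blast
  then show thesis using finite_imp_inj_to_nat_seg[of "UNIV :: ('a \<times> 'a) set"] nat by blast
next
  case False
  then have "\<exists>g. bij_betw g ((UNIV :: 'a set) \<times> (UNIV :: 'a set)) (UNIV :: 'a set)"
    using card_of_Times_same_infinite card_of_ordIso by blast
  then show thesis using self by (auto simp: bij_betw_def)
qed

section \<open>Syntactic congruences\<close>

text \<open>Translations: compositions of basic operations with all arguments but one held fixed. An
  equivalence that they preserve is a congruence.\<close>

inductive transl :: "'f set \<Rightarrow> ('f \<Rightarrow> nat) \<Rightarrow> ('a, 'f) alg \<Rightarrow> ('a \<Rightarrow> 'a) \<Rightarrow> bool"
  for F ar B where
  ident: "transl F ar B (\<lambda>x. x)"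
| opr: "transl F ar B h \<Longrightarrow> f \<in> F \<Longrightarrow> Suc (length us + length vs) = ar f \<Longrightarrow> set us \<subseteq> car B
    \<Longrightarrow> set vs \<subseteq> car B \<Longrightarrow> transl F ar B (\<lambda>x. opr B f (us @ h x # vs))"

lemma transl_comp: "transl F ar B g \<Longrightarrow> transl F ar B h \<Longrightarrow> transl F ar B (\<lambda>x. g (h x))"
  by (induction rule: transl.induct) (auto intro: transl.intros)

text \<open>The largest congruence for which \<open>S\<close> is a union of blocks.\<close>
definition syn :: "'f set \<Rightarrow> ('f \<Rightarrow> nat) \<Rightarrow> ('a, 'f) alg \<Rightarrow> 'a set \<Rightarrow> ('a \<times> 'a) set" where
  "syn F ar B S = {(x, y). x \<in> car B \<and> y \<in> car B \<and> (\<forall>h. transl F ar B h \<longrightarrow> (h x \<in> S \<longleftrightarrow> h y \<in> S))}"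

lemma syn_saturated: "(x, y) \<in> syn F ar B S \<Longrightarrow> x \<in> S \<longleftrightarrow> y \<in> S"
  unfolding syn_def using transl.ident[of F ar B] by auto

text \<open>Applying a one-place operation and then testing with \<open>h\<close> is testing with
  another translation.\<close>

lemma syn_Con:
  assumes "is_alg F ar B" shows "syn F ar B S \<in> Con F ar B"
proof (rule Con_one_placeI[OF assms])
  fix f us vs x y
  assume f: "f \<in> F" "Suc (length us + length vs) = ar f" "set us \<subseteq> car B" "set vs \<subseteq> car B"
    and xy: "(x, y) \<in> syn F ar B S"
  have tr: "transl F ar B (\<lambda>z. opr B f (us @ z # vs))"
    by (rule transl.opr[where h = "\<lambda>z. z"]) (simp_all add: f transl.ident)
  have "h (opr B f (us @ x # vs)) \<in> S \<longleftrightarrow> h (opr B f (us @ y # vs)) \<in> S" if "transl F ar B h" for h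
    using xy transl_comp[OF that tr] unfolding syn_def by auto
  then show "(opr B f (us @ x # vs), opr B f (us @ y # vs)) \<in> syn F ar B S"
    using xy f is_alg_opr[OF assms f(1)] unfolding syn_def by auto
qed (auto simp: syn_def)

section \<open>Translations as terms with parameters\<close>

fun rename :: "(nat \<Rightarrow> nat) \<Rightarrow> 'f trm \<Rightarrow> 'f trm" where
  "rename s (Var n) = Var (s n)"
| "rename s (App f ts) = App f (map (rename s) ts)"

lemma eval_rename: "eval A \<rho> (rename s t) = eval A (\<rho> \<circ> s) t"
  by (induction t) (auto simp: comp_def cong: map_cong)

lemma wf_rename: "wf_trm F ar t \<Longrightarrow> wf_trm F ar (rename s t)"
  by (induction t) auto

text \<open>Links syntactic congruences to the term condition: the argument becomes variable
  \<open>0\<close>, the fixed elements become values of other variables.\<close>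

lemma transl_term:
  assumes "transl F ar B h" and ne: "car B \<noteq> {}"
  shows "\<exists>t \<rho>. wf_trm F ar t \<and> (\<forall>i. \<rho> i \<in> car B) \<and> (\<forall>x. h x = eval B (\<rho>(0 := x)) t)"
  using assms(1)
proof induction
  case ident
  obtain e where "e \<in> car B" using ne by blast
  then show ?case by (intro exI[of _ "Var 0"] exI[of _ "\<lambda>_. e"]) simp
next
  case (opr h f us vs)
  then obtain t \<rho> where t: "wf_trm F ar t" and \<rho>: "\<And>i. \<rho> i \<in> car B"
    and h: "\<And>x. h x = eval B (\<rho>(0 := x)) t" by blast
  let ?k = "length us" and ?n = "ar f"
  \<comment> \<open>\<open>s\<close> keeps variable \<open>0\<close> and moves the other variables
    of \<open>t\<close> past \<open>1, ..., ar f\<close>, which are reserved for the arguments of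
    the new operation.\<close>
  define s where "s = (\<lambda>i. if i = 0 then 0 else i + ?n)"
  \<comment> \<open>\<open>\<rho> 0\<close> merely fills the hole at position
    \<open>length us\<close>, where \<open>ts\<close> places the renamed term.\<close>
  define w where "w = us @ \<rho> 0 # vs"
  \<comment> \<open>Variable \<open>Suc i\<close> carries entry \<open>i\<close> of
    \<open>w\<close>. At \<open>0\<close>, truncated subtraction gives \<open>\<rho> 0\<close>, a
    carrier element that the argument \<open>x\<close> overrides.\<close>
  define \<sigma> where "\<sigma> = (\<lambda>i. if 0 < i \<and> i \<le> ?n then w ! (i - 1) else \<rho> (i - ?n))"
  define ts where "ts = (map (\<lambda>i. Var (Suc i)) [0..<?n])[?k := rename s t]"
  have lw: "length w = ?n" and k: "?k < ?n" using opr.hyps by (auto simp: w_def)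
  have wcar: "set w \<subseteq> car B" using opr.hyps \<rho> by (auto simp: w_def)
  have "wf_trm F ar (App f ts)"
    using opr.hyps(2) wf_rename[OF t] set_update_subset_insert[of _ ?k "rename s t"]
    by (fastforce simp: ts_def)
  moreover have "\<sigma> i \<in> car B" for i
    using \<rho> wcar lw by (auto simp: \<sigma>_def subset_iff)
  moreover have "opr B f (us @ h x # vs) = eval B (\<sigma>(0 := x)) (App f ts)" for x
  proof -
    have comp: "(\<sigma>(0 := x)) \<circ> s = \<rho>(0 := x)" by (auto simp: s_def \<sigma>_def)
    have at_k: "map (eval B (\<sigma>(0 := x))) ts ! ?k = h x"
      using k by (simp add: ts_def eval_rename comp h)
    have upd: "us @ h x # vs = w[?k := h x]" by (simp add: w_def)
    have "map (eval B (\<sigma>(0 := x))) ts = us @ h x # vs"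
      unfolding upd
    proof (rule nth_equalityI)
      fix i assume i: "i < length (map (eval B (\<sigma>(0 := x))) ts)"
      show "map (eval B (\<sigma>(0 := x))) ts ! i = w[?k := h x] ! i"
        using at_k i k lw by (cases "i = ?k") (auto simp: ts_def \<sigma>_def)
    qed (simp add: ts_def lw)
    then show ?thesis by simp
  qed
  ultimately show ?case by blast
qed

section \<open>The term condition on the algebra of related pairs\<close>

definition pair_alg :: "('a, 'f) alg \<Rightarrow> ('a \<times> 'a) set \<Rightarrow> ('a \<times> 'a, 'f) alg" where
  "pair_alg A \<beta> = \<lparr>car = \<beta>, opr = \<lambda>f ps. (opr A f (map fst ps), opr A f (map snd ps))\<rparr>"

lemma car_pair_alg [simp]: "car (pair_alg A \<beta>) = \<beta>"
  by (simp add: pair_alg_def)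

lemma opr_pair_alg [simp]:
  "opr (pair_alg A \<beta>) f ps = (opr A f (map fst ps), opr A f (map snd ps))"
  by (simp add: pair_alg_def)

lemma eval_pair_alg: "eval (pair_alg A \<beta>) \<rho> t = (eval A (fst \<circ> \<rho>) t, eval A (snd \<circ> \<rho>) t)"
  by (induction t) (auto simp: comp_def cong: map_cong)

lemma pair_alg_in_var:
  assumes A: "in_var F ar Eq A" and \<beta>: "\<beta> \<in> Con F ar A"
  shows "in_var F ar Eq (pair_alg A \<beta>)"
proof -
  have "is_alg F ar A" using A by (rule in_var_is_alg)
  then obtain e where "e \<in> car A" unfolding is_alg_def by blast
  then have "\<beta> \<noteq> {}" using Con_refl[OF \<beta>] by blast
  moreover have "(opr A f (map fst ps), opr A f (map snd ps)) \<in> \<beta>"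
    if "f \<in> F" "length ps = ar f" "set ps \<subseteq> \<beta>" for f ps
    by (rule Con_compat[OF \<beta>]) (use that nth_mem[of _ ps] in \<open>auto simp: list_all2_conv_all_nth\<close>)
  ultimately have "is_alg F ar (pair_alg A \<beta>)" by (auto simp: is_alg_def)
  moreover have "eval (pair_alg A \<beta>) \<rho> s = eval (pair_alg A \<beta>) \<rho> t"
    if st: "(s, t) \<in> Eq" and \<rho>: "\<forall>n. \<rho> n \<in> \<beta>" for s t \<rho>
  proof -
    have "(fst \<circ> \<rho>) n \<in> car A" "(snd \<circ> \<rho>) n \<in> car A" for n
      using \<rho> Con_carD[OF \<beta>, of "fst (\<rho> n)" "snd (\<rho> n)"] by auto
    then show ?thesis using A st unfolding in_var_def by (fastforce simp: eval_pair_alg)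
  qed
  ultimately show ?thesis unfolding in_var_def by auto
qed

text \<open>An algebra is a member of the variety without equations.\<close>

lemma pair_alg_is_alg:
  assumes "is_alg F ar A" "\<beta> \<in> Con F ar A" shows "is_alg F ar (pair_alg A \<beta>)"
  using pair_alg_in_var[of F ar "{}" A \<beta>] assms unfolding in_var_def by auto

lemma hom_fst: "\<beta> \<in> Con F ar A \<Longrightarrow> is_hom F ar (pair_alg A \<beta>) A fst"
  unfolding is_hom_def using Con_carD by fastforce

lemma hom_snd: "\<beta> \<in> Con F ar A \<Longrightarrow> is_hom F ar (pair_alg A \<beta>) A snd"
  unfolding is_hom_def using Con_carD by fastforce

lemma hom_diag: "\<beta> \<in> Con F ar A \<Longrightarrow> is_hom F ar A (pair_alg A \<beta>) (\<lambda>x. (x, x))"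
  unfolding is_hom_def using Con_refl by (fastforce simp: comp_def)

text \<open>For congruences \<alpha>, \<beta> the term condition says that \<alpha> lies below this
  relation, see \<open>centralizes_iff\<close>. The pullback is along the diagonal embedding of
  \<open>A\<close> into \<beta>.\<close>

definition centralizer :: "'f set \<Rightarrow> ('f \<Rightarrow> nat) \<Rightarrow> ('a, 'f) alg \<Rightarrow>
    ('a \<times> 'a) set \<Rightarrow> ('a \<times> 'a) set \<Rightarrow> ('a \<times> 'a) set" where
  "centralizer F ar A \<beta> \<delta> = pull A (\<lambda>x. (x, x)) (syn F ar (pair_alg A \<beta>) \<delta>)"

lemma centralizer_Con:
  assumes "is_alg F ar A" "\<beta> \<in> Con F ar A"
  shows "centralizer F ar A \<beta> \<delta> \<in> Con F ar A"
  unfolding centralizer_def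
  by (rule pull_Con[OF assms(1) hom_diag[OF assms(2)] syn_Con[OF pair_alg_is_alg[OF assms]]])

text \<open>\<open>t\<close> is evaluated in the algebra on \<beta>: variables in \<open>X\<close>
  receive diagonal pairs, which change from \<open>a\<close> to \<open>b\<close> within \<Theta>,
  and the others keep the pairs \<open>(c i, d i)\<close>.\<close>

lemma eval_mix_Con:
  assumes \<beta>: "\<beta> \<in> Con F ar A" and \<Theta>: "\<Theta> \<in> Con F ar (pair_alg A \<beta>)" and t: "wf_trm F ar t"
    and ab: "\<And>i. ((a i, a i), (b i, b i)) \<in> \<Theta>" and cd: "\<And>i. (c i, d i) \<in> \<beta>"
  shows "((eval A (mix X a c) t, eval A (mix X a d) t),
          (eval A (mix X b c) t, eval A (mix X b d) t)) \<in> \<Theta>"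
proof -
  have "(eval (pair_alg A \<beta>) (\<lambda>i. (mix X a c i, mix X a d i)) t,
         eval (pair_alg A \<beta>) (\<lambda>i. (mix X b c i, mix X b d i)) t) \<in> \<Theta>"
    by (rule eval_Con[OF \<Theta> _ t]) (auto simp: mix_def ab cd intro: Con_refl[OF \<Theta>])
  then show ?thesis by (simp add: eval_pair_alg comp_def)
qed

text \<open>A translation of the algebra on \<beta> is a term with parameters in \<beta>, so the
  term condition with a single \<alpha>-variable forbids it to separate \<open>(u, u)\<close> from
  \<open>(v, v)\<close> by \<delta>. Conversely, \<open>syn\<close> is compatible with terms in any
  number of such variables and saturates \<delta>.\<close>

lemma centralizes_iff:
  assumes alg: "is_alg F ar A" and \<alpha>: "\<alpha> \<in> Con F ar A" and \<beta>: "\<beta> \<in> Con F ar A"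
  shows "centralizes F ar A \<alpha> \<beta> \<delta> \<longleftrightarrow> \<alpha> \<subseteq> centralizer F ar A \<beta> \<delta>"
proof
  let ?B = "pair_alg A \<beta>"
  assume C: "centralizes F ar A \<alpha> \<beta> \<delta>"
  have step: "h (v, v) \<in> \<delta>" if uv: "(u, v) \<in> \<alpha>" and h: "transl F ar ?B h" and hu: "h (u, u) \<in> \<delta>" for u v h
  proof -
    have "car ?B \<noteq> {}" using Con_refl[OF \<beta>] Con_carD[OF \<alpha> uv] by auto
    from transl_term[OF h this] obtain t \<rho> where t: "wf_trm F ar t" and \<rho>: "\<And>i. \<rho> i \<in> \<beta>"
      and eq: "\<And>x. h x = eval ?B (\<rho>(0 := x)) t" by auto
    \<comment> \<open>Only variable \<open>0\<close> carries the diagonal argument, which explains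
      the choice \<open>{0}\<close> for \<open>X\<close>; the remaining variables carry the
      coordinates of the parameters.\<close>
    have env: "fst \<circ> \<rho>(0 := (x, x)) = mix {0} (\<lambda>_. x) (fst \<circ> \<rho>)"
      "snd \<circ> \<rho>(0 := (x, x)) = mix {0} (\<lambda>_. x) (snd \<circ> \<rho>)" for x
      by (auto simp: mix_def)
    have *: "h (x, x) = (eval A (mix {0} (\<lambda>_. x) (fst \<circ> \<rho>)) t, eval A (mix {0} (\<lambda>_. x) (snd \<circ> \<rho>)) t)" for x
      unfolding eq eval_pair_alg env ..
    have "\<forall>i. ((fst \<circ> \<rho>) i, (snd \<circ> \<rho>) i) \<in> \<beta>" using \<rho> by simp
    then show ?thesis
      using C[unfolded centralizes_def, rule_format, of t "\<lambda>_. u" "\<lambda>_. v" "fst \<circ> \<rho>" "snd \<circ> \<rho>" "{0}"]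
        t uv hu unfolding * by simp
  qed
  show "\<alpha> \<subseteq> centralizer F ar A \<beta> \<delta>"
  proof clarify
    fix u v assume uv: "(u, v) \<in> \<alpha>"
    show "(u, v) \<in> centralizer F ar A \<beta> \<delta>"
      using step[OF uv] step[OF Con_sym[OF \<alpha> uv]] Con_carD[OF \<alpha> uv] Con_refl[OF \<beta>]
      unfolding centralizer_def pull_iff syn_def by auto
  qed
next
  assume le: "\<alpha> \<subseteq> centralizer F ar A \<beta> \<delta>"
  note syn = syn_Con[OF pair_alg_is_alg[OF alg \<beta>], of \<delta>]
  show "centralizes F ar A \<alpha> \<beta> \<delta>"
    unfolding centralizes_def
  proof (intro allI impI, elim conjE)
    fix t X a b c d
    assume t: "wf_trm F ar t" and ab: "\<forall>i. (a i, b i) \<in> \<alpha>" and cd: "\<forall>i. (c i, d i) \<in> \<beta>"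
      and mem: "(eval A (mix X a c) t, eval A (mix X a d) t) \<in> \<delta>"
    have "((a i, a i), (b i, b i)) \<in> syn F ar (pair_alg A \<beta>) \<delta>" for i
      using ab le unfolding centralizer_def by (auto simp: pull_iff)
    from syn_saturated[OF eval_mix_Con[OF \<beta> syn t, of a b c d X]] this cd mem
    show "(eval A (mix X b c) t, eval A (mix X b d) t) \<in> \<delta>" by blast
  qed
qed

text \<open>\<open>t(b, c)\<close> and \<open>t(b, d)\<close> are \<beta>-related because
  \<open>c\<close> and \<open>d\<close> are, and \<alpha>-related by way of \<open>t(a, c)\<close>
  and \<open>t(a, d)\<close>, since \<open>\<delta> \<subseteq> \<alpha>\<close>.\<close>

lemma centralizes_inter:
  assumes \<alpha>: "\<alpha> \<in> Con F ar A" and \<beta>: "\<beta> \<in> Con F ar A" and \<delta>: "\<delta> \<in> Con F ar A"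
    and le: "\<alpha> \<inter> \<beta> \<subseteq> \<delta>" "\<delta> \<subseteq> \<alpha>"
  shows "centralizes F ar A \<alpha> \<beta> \<delta>"
  unfolding centralizes_def
proof (intro allI impI, elim conjE)
  fix t X a b c d
  assume t: "wf_trm F ar t" and ab: "\<forall>i. (a i, b i) \<in> \<alpha>" and cd: "\<forall>i. (c i, d i) \<in> \<beta>"
    and mem: "(eval A (mix X a c) t, eval A (mix X a d) t) \<in> \<delta>"
  have car: "a i \<in> car A" "b i \<in> car A" "c i \<in> car A" "d i \<in> car A" for i
    using ab cd Con_carD[OF \<alpha>] Con_carD[OF \<beta>] by blast+
  have 1: "(eval A (mix X a e) t, eval A (mix X b e) t) \<in> \<alpha>" if "\<And>i. e i \<in> car A" for e
    by (rule eval_Con[OF \<alpha> _ t]) (use ab that in \<open>auto simp: mix_def intro: Con_refl[OF \<alpha>]\<close>)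
  have "(eval A (mix X b c) t, eval A (mix X b d) t) \<in> \<beta>"
    by (rule eval_Con[OF \<beta> _ t]) (use cd car in \<open>auto simp: mix_def intro: Con_refl[OF \<beta>]\<close>)
  moreover have "(eval A (mix X b c) t, eval A (mix X b d) t) \<in> \<alpha>"
    using 1[of c] 1[of d] car mem le(2) Con_trans[OF \<alpha>] Con_sym[OF \<alpha>] by (meson subsetD)
  ultimately show "(eval A (mix X b c) t, eval A (mix X b d) t) \<in> \<delta>" using le(1) by blast
qed

section \<open>The commutator\<close>

lemma comm_le_inter:
  assumes "\<alpha> \<in> Con F ar A" "\<beta> \<in> Con F ar A"
  shows "comm F ar A \<alpha> \<beta> \<subseteq> \<alpha> \<inter> \<beta>"
  using centralizes_inter[OF assms Int_Con[OF assms]] Int_Con[OF assms] unfolding comm_def by auto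

text \<open>The meet \<open>\<alpha> \<inter> \<beta>\<close> belongs to the intersected family,
  which is therefore nonempty.\<close>

lemma comm_Con:
  assumes "\<alpha> \<in> Con F ar A" "\<beta> \<in> Con F ar A"
  shows "comm F ar A \<alpha> \<beta> \<in> Con F ar A"
  unfolding comm_def
  by (rule Inter_Con) (use centralizes_inter[OF assms Int_Con[OF assms]] Int_Con[OF assms] in auto)

text \<open>For fixed \<alpha> and \<beta>, the term condition passes to intersections of the
  congruences \<delta>.\<close>

lemma centralizes_comm: "centralizes F ar A \<alpha> \<beta> (comm F ar A \<alpha> \<beta>)"
  unfolding centralizes_def
proof (intro allI impI, elim conjE)
  fix t X a b c d
  assume H: "wf_trm F ar t" "\<forall>i. (a i, b i) \<in> \<alpha>" "\<forall>i. (c i, d i) \<in> \<beta>"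
    and mem: "(eval A (mix X a c) t, eval A (mix X a d) t) \<in> comm F ar A \<alpha> \<beta>"
  have "(eval A (mix X b c) t, eval A (mix X b d) t) \<in> \<delta>"
    if \<delta>: "\<delta> \<in> Con F ar A" and C: "centralizes F ar A \<alpha> \<beta> \<delta>" for \<delta>
  proof -
    have "(eval A (mix X a c) t, eval A (mix X a d) t) \<in> \<delta>"
      using mem \<delta> C by (simp add: comm_def)
    then show ?thesis using C[unfolded centralizes_def, rule_format, of t a b c d X] H by simp
  qed
  then show "(eval A (mix X b c) t, eval A (mix X b d) t) \<in> comm F ar A \<alpha> \<beta>"
    by (simp add: comm_def)
qed

section \<open>Semidegenerate congruence modular varieties\<close>

text \<open>\<open>'a\<close> and \<open>nat\<close> are the two types into which pairs of elements
  of \<open>A\<close> can be embedded.\<close>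

locale sdcm_algebra =
  fixes F :: "'f set" and ar :: "'f \<Rightarrow> nat" and Eq :: "('f trm \<times> 'f trm) set"
    and A :: "('a, 'f) alg"
  assumes fin: "finite F"
    and eqs: "eqns F ar Eq"
    and cm_nat: "cong_modular_on F ar Eq TYPE(nat)"
    and cm_a: "cong_modular_on F ar Eq TYPE('a)"
    and sd_nat: "semidegenerate_on F ar Eq TYPE(nat)"
    and sd_a: "semidegenerate_on F ar Eq TYPE('a)"
    and AV: "in_var F ar Eq A"
begin

lemma alg: "is_alg F ar A"
  using AV by (rule in_var_is_alg)

lemma pair_shifting:
  assumes "\<beta> \<in> Con F ar A" shows "shifting F ar (pair_alg A \<beta>)"
proof (rule inj_prod_cases[where 'a = 'a])
  fix g :: "'a \<times> 'a \<Rightarrow> 'a" assume "inj g"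
  then show ?thesis
    by (intro cong_modular_on_shifting[OF cm_a eqs _ pair_alg_in_var[OF AV assms], of g])
      (rule inj_on_subset, auto)
next
  fix g :: "'a \<times> 'a \<Rightarrow> nat" assume "inj g"
  then show ?thesis
    by (intro cong_modular_on_shifting[OF cm_nat eqs _ pair_alg_in_var[OF AV assms], of g])
      (rule inj_on_subset, auto)
qed

lemma pair_collapse:
  assumes \<beta>: "\<beta> \<in> Con F ar A" and \<Theta>: "\<Theta> \<in> Con F ar (pair_alg A \<beta>)" and e: "e \<in> \<beta>"
    and idem: "\<And>f. f \<in> F \<Longrightarrow> (opr (pair_alg A \<beta>) f (replicate (ar f) e), e) \<in> \<Theta>"
  shows "\<Theta> = Nabla (pair_alg A \<beta>)"
proof (rule inj_prod_cases[where 'a = 'a])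
  fix g :: "'a \<times> 'a \<Rightarrow> 'a" assume "inj g"
  then have "inj_on g (car (pair_alg A \<beta>))" by (rule inj_on_subset) auto
  from semidegenerate_collapse[OF sd_a eqs this pair_alg_in_var[OF AV \<beta>] \<Theta> _ idem] e
  show ?thesis by simp
next
  fix g :: "'a \<times> 'a \<Rightarrow> nat" assume "inj g"
  then have "inj_on g (car (pair_alg A \<beta>))" by (rule inj_on_subset) auto
  from semidegenerate_collapse[OF sd_nat eqs this pair_alg_in_var[OF AV \<beta>] \<Theta> _ idem] e
  show ?thesis by simp
qed

text \<open>Identifying \<open>e\<close> with \<open>f(e, ..., e)\<close> for every \<open>f\<close>
  in \<open>F\<close> turns the block of \<open>e\<close> into a one-element subalgebra of the
  quotient, so the quotient is trivial; finiteness of \<open>F\<close> keeps \<open>G\<close>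
  finite.\<close>

lemma Nabla_finitely_generated:
  obtains G where "finite G" "G \<subseteq> Nabla A" "cg F ar A G = Nabla A"
proof -
  obtain e where e: "e \<in> car A" using alg unfolding is_alg_def by blast
  define G where "G = (\<lambda>f. (opr A f (replicate (ar f) e), e)) ` F"
  have sub: "G \<subseteq> Nabla A" using e by (auto simp: G_def Nabla_def intro!: is_alg_opr[OF alg])
  have "cg F ar A G = Nabla A"
    by (rule semidegenerate_collapse[OF sd_a eqs inj_on_id AV cg_Con[OF alg sub] e])
      (use subset_cg[of G F ar A] in \<open>auto simp: G_def\<close>)
  then show thesis using that[of G] sub fin by (simp add: G_def)
qed

lemma Nabla_compact: "Nabla A \<in> Kc F ar A"
proof -
  obtain G where "finite G" "G \<subseteq> Nabla A" "cg F ar A G = Nabla A" by (rule Nabla_finitely_generated)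
  then show ?thesis using cg_finite_compact[OF alg, of G] by simp
qed

text \<open>In a modular variety the term condition only depends on \<open>\<delta>\<close> lying above the commutator. With
  \<open>\<Gamma>\<close> the congruence on \<open>\<beta>\<close> that identifies the diagonal pairs of \<open>\<alpha>\<close>, a first shift moves
  \<open>((x, y), (x, z)) \<in> \<Gamma>\<close> to \<open>((y, y), (y, z)) \<in> \<Gamma>\<close>, and a second one moves membership in \<open>\<delta>\<close> along \<open>\<Gamma>\<close>.\<close>
lemma centralizes_mono:
  assumes \<alpha>: "\<alpha> \<in> Con F ar A" and \<beta>: "\<beta> \<in> Con F ar A" and \<gamma>: "\<gamma> \<in> Con F ar A" and \<delta>: "\<delta> \<in> Con F ar A"
    and C: "centralizes F ar A \<alpha> \<beta> \<gamma>" and le: "\<gamma> \<subseteq> \<delta>"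
  shows "centralizes F ar A \<alpha> \<beta> \<delta>"
proof -
  let ?B = "pair_alg A \<beta>"
  have algB: "is_alg F ar ?B" by (rule pair_alg_is_alg[OF alg \<beta>])
  define \<eta>0 where "\<eta>0 = pull ?B fst (Delta A)"
  define \<eta>1 where "\<eta>1 = pull ?B snd (Delta A)"
  \<comment> \<open>Meeting with the pullback of \<alpha> makes the first coordinates of
    \<Gamma>-related pairs \<alpha>-related, so that the diagonal pairs over them are
    \<Gamma>-related too.\<close>
  define \<Gamma> where "\<Gamma> = syn F ar ?B \<gamma> \<inter> pull ?B fst \<alpha>"
  define \<delta>1 where "\<delta>1 = pull ?B snd \<delta>"
  note shift = pair_shifting[OF \<beta>, unfolded shifting_def, rule_format]
  note pf = pull_Con[OF algB hom_fst[OF \<beta>]] and ps = pull_Con[OF algB hom_snd[OF \<beta>]]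
  have Con: "\<eta>0 \<in> Con F ar ?B" "\<eta>1 \<in> Con F ar ?B" "\<Gamma> \<in> Con F ar ?B" "\<delta>1 \<in> Con F ar ?B"
    unfolding \<eta>0_def \<eta>1_def \<Gamma>_def \<delta>1_def
    using pf[OF Delta_Con[OF alg]] ps[OF Delta_Con[OF alg]] Int_Con[OF syn_Con[OF algB] pf[OF \<alpha>]] ps[OF \<delta>]
    by auto
  have \<eta>0: "((x, y), (x', y')) \<in> \<eta>0 \<longleftrightarrow> (x, y) \<in> \<beta> \<and> (x', y') \<in> \<beta> \<and> x = x'" for x y x' y'
    using Con_carD[OF \<beta>] by (auto simp: \<eta>0_def pull_iff Delta_def Id_on_iff)
  have \<eta>1: "((x, y), (x', y')) \<in> \<eta>1 \<longleftrightarrow> (x, y) \<in> \<beta> \<and> (x', y') \<in> \<beta> \<and> y = y'" for x y x' y'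
    using Con_carD[OF \<beta>] by (auto simp: \<eta>1_def pull_iff Delta_def Id_on_iff)
  have \<delta>1: "((x, y), (x', y')) \<in> \<delta>1 \<longleftrightarrow> (x, y) \<in> \<beta> \<and> (x', y') \<in> \<beta> \<and> (y, y') \<in> \<delta>" for x y x' y'
    by (simp add: \<delta>1_def pull_iff)
  have diag: "((u, u), (v, v)) \<in> \<Gamma>" if "(u, v) \<in> \<alpha>" for u v
    using C that Con_refl[OF \<beta>] Con_carD[OF \<alpha> that] unfolding centralizes_iff[OF alg \<alpha> \<beta>]
    by (auto simp: centralizer_def \<Gamma>_def pull_iff)
  have first: "(y, z) \<in> \<gamma>" if "((x, y), (x, z)) \<in> \<Gamma>" for x y z
  proof -
    have xy: "(x, y) \<in> \<beta>" "(x, z) \<in> \<beta>" using Con_carD[OF Con(3) that] by auto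
    have yz: "(y, z) \<in> \<beta>" using xy Con_trans[OF \<beta>] Con_sym[OF \<beta>] by blast
    have yy: "y \<in> car A" "(y, y) \<in> \<beta>" using Con_carD[OF \<beta> yz] Con_refl[OF \<beta>] by auto
    have triv: "\<eta>0 \<inter> \<eta>1 \<subseteq> \<Gamma>"
    proof (rule subrelI)
      fix p q assume pq: "(p, q) \<in> \<eta>0 \<inter> \<eta>1"
      then have "p = q" using \<eta>0 \<eta>1 by (cases p, cases q) simp
      then show "(p, q) \<in> \<Gamma>" using pq Con_carD[OF Con(1), of p q] Con_refl[OF Con(3), of p] by simp
    qed
    \<comment> \<open>The rectangle has \<open>\<eta>0\<close>-sides from \<open>(y, y)\<close> to
      \<open>(y, z)\<close> and from \<open>(x, y)\<close> to \<open>(x, z)\<close>;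
      \<open>\<eta>1\<close> joins corresponding corners.\<close>
    have "((y, y), (y, z)) \<in> \<Gamma>"
      using shift[OF Con(1,2,3) triv, of "(y, y)" "(x, y)" "(y, z)" "(x, z)"]
        xy yz yy that by (simp add: \<eta>0 \<eta>1)
    then have "((y, y), (y, z)) \<in> syn F ar ?B \<gamma>" by (simp add: \<Gamma>_def)
    from syn_saturated[OF this] show ?thesis using Con_refl[OF \<gamma> yy(1)] by simp
  qed
  have second: "(x', y') \<in> \<delta>" if \<Gamma>: "((x, y), (x', y')) \<in> \<Gamma>" and xy: "(x, y) \<in> \<delta>" for x y x' y'
  proof -
    have b: "(x, y) \<in> \<beta>" "(x', y') \<in> \<beta>" using Con_carD[OF Con(3) \<Gamma>] by auto
    then have r: "(x, x) \<in> \<beta>" "(x', x') \<in> \<beta>"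
      using Con_carD[OF \<beta> b(1)] Con_carD[OF \<beta> b(2)] by (simp_all add: Con_refl[OF \<beta>])
    have a: "(x', x) \<in> \<alpha>" using \<Gamma> Con_sym[OF \<alpha>] by (auto simp: \<Gamma>_def pull_iff)
    have sub: "\<eta>0 \<inter> \<Gamma> \<subseteq> \<delta>1"
    proof (rule subrelI)
      fix p q assume pq: "(p, q) \<in> \<eta>0 \<inter> \<Gamma>"
      obtain u v u' v' where [simp]: "p = (u, v)" "q = (u', v')" by (cases p, cases q)
      show "(p, q) \<in> \<delta>1" using pq first[of u v v'] le by (auto simp: \<eta>0 \<delta>1)
    qed
    \<comment> \<open>Now \<Gamma> takes the place of \<open>\<eta>1\<close>, joining
      \<open>(x', y')\<close> to \<open>(x, y)\<close> and \<open>(x', x')\<close> to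
      \<open>(x, x)\<close>. Membership of \<open>(x, y)\<close> in \<delta> is read as
      \<open>\<delta>1\<close> relating \<open>(x, y)\<close> to \<open>(x, x)\<close>.\<close>
    have "((x', y'), (x', x')) \<in> \<delta>1"
      using shift[OF Con(1,3,4) sub, of "(x', y')" "(x, y)" "(x', x')" "(x, x)"]
        b r diag[OF a] Con_sym[OF Con(3) \<Gamma>] Con_sym[OF \<delta> xy] by (simp add: \<eta>0 \<delta>1)
    then show ?thesis using Con_sym[OF \<delta>] by (simp add: \<delta>1)
  qed
  show ?thesis
    unfolding centralizes_def
  proof (intro allI impI, elim conjE)
    fix t X a b c d
    assume t: "wf_trm F ar t" and ab: "\<forall>i. (a i, b i) \<in> \<alpha>" and cd: "\<forall>i. (c i, d i) \<in> \<beta>"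
      and mem: "(eval A (mix X a c) t, eval A (mix X a d) t) \<in> \<delta>"
    show "(eval A (mix X b c) t, eval A (mix X b d) t) \<in> \<delta>"
      by (rule second[OF eval_mix_Con[OF \<beta> Con(3) t] mem]) (use ab cd diag in auto)
  qed
qed

text \<open>If all diagonal pairs are identified by a congruence on \<open>\<beta>\<close>, the quotient has a one-element
  subalgebra and is therefore trivial.\<close>
lemma centralizes_cover:
  assumes Con: "\<alpha>\<^sub>1 \<in> Con F ar A" "\<alpha>\<^sub>2 \<in> Con F ar A" "\<beta> \<in> Con F ar A" "\<delta> \<in> Con F ar A"
    and C: "centralizes F ar A \<alpha>\<^sub>1 \<beta> \<delta>" "centralizes F ar A \<alpha>\<^sub>2 \<beta> \<delta>"
    and cover: "cjoin F ar A \<alpha>\<^sub>1 \<alpha>\<^sub>2 = Nabla A"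
  shows "\<beta> \<subseteq> \<delta>"
proof -
  let ?B = "pair_alg A \<beta>"
  have "Nabla A \<subseteq> centralizer F ar A \<beta> \<delta>"
    using C unfolding cover[symmetric] cjoin_subset_iff[OF centralizer_Con[OF alg Con(3)]]
    by (simp add: centralizes_iff[OF alg] Con)
  then have diag: "((u, u), (v, v)) \<in> syn F ar ?B \<delta>" if "u \<in> car A" "v \<in> car A" for u v
    using that by (auto simp: centralizer_def pull_iff Nabla_def)
  obtain e where e: "e \<in> car A" using alg unfolding is_alg_def by blast
  have "syn F ar ?B \<delta> = Nabla ?B"
    by (rule pair_collapse[OF Con(3) syn_Con[OF pair_alg_is_alg[OF alg Con(3)]], of "(e, e)"])
      (use e Con_refl[OF Con(3)] in \<open>auto intro!: diag is_alg_opr[OF alg]\<close>)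
  then have "((e, e), p) \<in> syn F ar ?B \<delta>" if "p \<in> \<beta>" for p
    using that Con_refl[OF Con(3) e] by (simp add: Nabla_def)
  from syn_saturated[OF this] show ?thesis using Con_refl[OF Con(4) e] by (intro subsetI) simp
qed

section \<open>The prime spectrum\<close>

text \<open>Modulo \<phi>, both \<alpha> and \<phi> centralize \<beta>. If their join were
  \<open>Nabla A\<close>, then \<open>centralizes_cover\<close> would give
  \<open>\<beta> \<subseteq> \<phi>\<close>; otherwise maximality makes the join equal to
  \<phi>.\<close>

lemma maximal_prime:
  assumes \<phi>: "\<phi> \<in> Con F ar A" "\<phi> \<noteq> Nabla A"
    and max: "\<And>\<theta>. \<theta> \<in> Con F ar A \<Longrightarrow> \<phi> \<subseteq> \<theta> \<Longrightarrow> \<theta> \<noteq> \<phi> \<Longrightarrow> \<theta> = Nabla A"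
  shows "is_prime F ar A \<phi>"
  unfolding is_prime_def
proof (intro conjI ballI impI \<phi>)
  fix \<alpha> \<beta> assume \<alpha>: "\<alpha> \<in> Con F ar A" and \<beta>: "\<beta> \<in> Con F ar A" and le: "comm F ar A \<alpha> \<beta> \<subseteq> \<phi>"
  show "\<alpha> \<subseteq> \<phi> \<or> \<beta> \<subseteq> \<phi>"
  proof (rule disjCI)
    assume "\<not> \<beta> \<subseteq> \<phi>"
    have J: "cjoin F ar A \<alpha> \<phi> \<in> Con F ar A" by (rule cjoin_Con[OF alg \<alpha> \<phi>(1)])
    have sub: "\<alpha> \<subseteq> cjoin F ar A \<alpha> \<phi>" "\<phi> \<subseteq> cjoin F ar A \<alpha> \<phi>" using cjoin_subset_iff[OF J, of \<alpha> \<phi>] by simp_all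
    have "cjoin F ar A \<alpha> \<phi> \<noteq> Nabla A"
      using centralizes_cover[OF \<alpha> \<phi>(1) \<beta> \<phi>(1)
          centralizes_mono[OF \<alpha> \<beta> comm_Con[OF \<alpha> \<beta>] \<phi>(1) centralizes_comm le]
          centralizes_inter[OF \<phi>(1) \<beta> \<phi>(1)]] \<open>\<not> \<beta> \<subseteq> \<phi>\<close> by blast
    then show "\<alpha> \<subseteq> \<phi>" using max[OF J sub(2)] sub(1) by blast
  qed
qed

text \<open>Zorn's lemma yields a maximal proper congruence above \<theta>: if a chain had union
  \<open>Nabla A\<close>, one of its members would already contain the finite generating set
  \<open>G\<close>.\<close>

lemma prime_above:
  assumes \<theta>: "\<theta> \<in> Con F ar A" "\<theta> \<noteq> Nabla A"
  obtains \<phi> where "\<phi> \<in> Spec F ar A" "\<theta> \<subseteq> \<phi>"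
proof -
  let ?S = "{\<psi> \<in> Con F ar A. \<theta> \<subseteq> \<psi> \<and> \<psi> \<noteq> Nabla A}"
  obtain G where G: "finite G" "G \<subseteq> Nabla A" "cg F ar A G = Nabla A"
    by (rule Nabla_finitely_generated)
  have chain: "\<Union>C \<in> ?S" if ne: "C \<noteq> {}" and ch: "subset.chain ?S C" for C
  proof -
    have C: "C \<subseteq> ?S" using ch by (simp add: subset.chain_def)
    have "\<Union>C \<in> Con F ar A"
    proof (rule directed_Union_Con[OF _ ne])
      fix \<alpha> \<beta> assume "\<alpha> \<in> C" "\<beta> \<in> C"
      then have "\<alpha> \<subseteq> \<beta> \<or> \<beta> \<subseteq> \<alpha>" using ch by (auto simp: subset.chain_def)
      then show "\<exists>\<gamma>\<in>C. \<alpha> \<union> \<beta> \<subseteq> \<gamma>" using \<open>\<alpha> \<in> C\<close> \<open>\<beta> \<in> C\<close> by blast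
    qed (use C in blast)
    moreover have "\<Union>C \<noteq> Nabla A"
    proof
      assume "\<Union>C = Nabla A"
      then obtain \<psi> where \<psi>: "\<psi> \<in> C" "G \<subseteq> \<psi>"
        using finite_subset_Union_chain[OF G(1) _ ne ch] G(2) by blast
      then have "Nabla A \<subseteq> \<psi>" using cg_least[of \<psi> F ar A G] G(3) C by blast
      then show False using \<psi>(1) C Con_subset by blast
    qed
    ultimately show ?thesis using C ne by blast
  qed
  have "\<theta> \<in> ?S" using \<theta> by simp
  then have "?S \<noteq> {}" by (rule ex_in_conv[THEN iffD1, OF exI])
  from subset_Zorn_nonempty[OF this chain]
  obtain \<phi> where \<phi>: "\<phi> \<in> ?S" and max: "\<forall>\<psi>\<in>?S. \<phi> \<subseteq> \<psi> \<longrightarrow> \<psi> = \<phi>" by (rule bexE)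
  have "is_prime F ar A \<phi>"
  proof (rule maximal_prime)
    fix \<psi> assume \<psi>: "\<psi> \<in> Con F ar A" "\<phi> \<subseteq> \<psi>" "\<psi> \<noteq> \<phi>"
    show "\<psi> = Nabla A"
    proof (rule ccontr)
      assume "\<psi> \<noteq> Nabla A"
      then have "\<psi> \<in> ?S" using \<phi> \<psi>(1,2) by auto
      then show False using max \<psi>(2,3) by simp
    qed
  qed (use \<phi> in auto)
  then show thesis using that[of \<phi>] \<phi> by (simp add: Spec_def)
qed

section \<open>The sets \<open>D(\<theta>)\<close> and Boolean operations\<close>

lemma Spec_Con: "\<phi> \<in> Spec F ar A \<Longrightarrow> \<phi> \<in> Con F ar A"
  by (simp add: Spec_def is_prime_def)

lemma DA_iff: "\<phi> \<in> DA F ar A \<theta> \<longleftrightarrow> \<phi> \<in> Spec F ar A \<and> \<not> \<theta> \<subseteq> \<phi>"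
  by (auto simp: DA_def VA_def)

lemma DA_mono: "\<alpha> \<subseteq> \<beta> \<Longrightarrow> DA F ar A \<alpha> \<subseteq> DA F ar A \<beta>"
  by (rule subsetI) (use DA_iff order_trans in meson)

lemma DA_cjoin: "DA F ar A (cjoin F ar A \<alpha> \<beta>) = DA F ar A \<alpha> \<union> DA F ar A \<beta>"
proof (rule set_eqI)
  fix \<phi>
  show "\<phi> \<in> DA F ar A (cjoin F ar A \<alpha> \<beta>) \<longleftrightarrow> \<phi> \<in> DA F ar A \<alpha> \<union> DA F ar A \<beta>"
    using cjoin_subset_iff[OF Spec_Con, of \<phi> \<alpha> \<beta>] unfolding Un_iff DA_iff by blast
qed

text \<open>The commutator lies below the meet, so a prime above the meet is above one of the two
  congruences.\<close>

lemma DA_inter: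
  assumes "\<alpha> \<in> Con F ar A" "\<beta> \<in> Con F ar A"
  shows "DA F ar A (\<alpha> \<inter> \<beta>) = DA F ar A \<alpha> \<inter> DA F ar A \<beta>"
proof -
  have "\<alpha> \<inter> \<beta> \<subseteq> \<phi> \<longleftrightarrow> \<alpha> \<subseteq> \<phi> \<or> \<beta> \<subseteq> \<phi>" if "\<phi> \<in> Spec F ar A" for \<phi>
    using that comm_le_inter[OF assms] assms unfolding Spec_def is_prime_def by blast
  then show ?thesis by (auto simp: DA_iff)
qed

lemma DA_Delta: "DA F ar A (Delta A) = {}"
  using Delta_subset Spec_Con by (fastforce simp: DA_iff)

lemma DA_Nabla: "DA F ar A (Nabla A) = Spec F ar A"
proof -
  have "\<not> Nabla A \<subseteq> \<phi>" if "\<phi> \<in> Spec F ar A" for \<phi>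
    using that Con_subset[OF Spec_Con[OF that]] by (auto simp: Spec_def is_prime_def)
  then show ?thesis by (auto simp: DA_iff)
qed

text \<open>A proper congruence lies below some prime, which is then missing from its
  \<open>D\<close>.\<close>

lemma DA_eq_Spec_iff:
  assumes "\<theta> \<in> Con F ar A"
  shows "DA F ar A \<theta> = Spec F ar A \<longleftrightarrow> \<theta> = Nabla A"
  using prime_above[OF assms] DA_Nabla by (metis DA_iff)

lemma DA_complement:
  assumes "\<alpha> \<in> Con F ar A" "\<beta> \<in> Con F ar A" "\<alpha> \<inter> \<beta> = Delta A" "cjoin F ar A \<alpha> \<beta> = Nabla A"
  shows "DA F ar A \<beta> = Spec F ar A - DA F ar A \<alpha>"
  using DA_inter[OF assms(1,2)] DA_cjoin[of \<alpha> \<beta>] DA_Delta DA_Nabla unfolding assms(3,4) by blast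

lemma DA_BCon_Clop:
  assumes "\<alpha> \<in> BCon F ar A" shows "DA F ar A \<alpha> \<in> Clop F ar A"
proof -
  obtain \<beta> where "\<alpha> \<in> Con F ar A" "\<beta> \<in> Con F ar A" "\<alpha> \<inter> \<beta> = Delta A" "cjoin F ar A \<alpha> \<beta> = Nabla A"
    using assms unfolding BCon_def by blast
  then show ?thesis
    using DA_complement[of \<alpha> \<beta>] unfolding Clop_def spec_open_def by (auto simp: DA_iff)
qed

text \<open>Gives injectivity on \<open>BCon\<close>. For a complement \<open>\<alpha>'\<close> of
  \<alpha>, the hypothesis forces the join of \<open>\<alpha>'\<close> and \<beta> to be
  \<open>Nabla A\<close>. Both centralize \<alpha> modulo \<open>\<alpha> \<inter> \<beta>\<close>,
  so \<open>centralizes_cover\<close> yields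
  \<open>\<alpha> \<subseteq> \<alpha> \<inter> \<beta>\<close>.\<close>

lemma BCon_DA_mono:
  assumes \<alpha>: "\<alpha> \<in> BCon F ar A" and \<beta>: "\<beta> \<in> Con F ar A" and le: "DA F ar A \<alpha> \<subseteq> DA F ar A \<beta>"
  shows "\<alpha> \<subseteq> \<beta>"
proof -
  obtain \<alpha>' where Con: "\<alpha> \<in> Con F ar A" "\<alpha>' \<in> Con F ar A"
    and compl: "\<alpha> \<inter> \<alpha>' = Delta A" "cjoin F ar A \<alpha> \<alpha>' = Nabla A"
    using \<alpha> unfolding BCon_def by blast
  let ?\<delta> = "\<alpha> \<inter> \<beta>"
  have \<delta>: "?\<delta> \<in> Con F ar A" by (rule Int_Con[OF Con(1) \<beta>])
  have "DA F ar A (cjoin F ar A \<alpha>' \<beta>) = Spec F ar A"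
    using le DA_complement[OF Con compl] DA_cjoin[of \<alpha>' \<beta>] by (auto simp: DA_iff)
  then have cover: "cjoin F ar A \<alpha>' \<beta> = Nabla A"
    using DA_eq_Spec_iff cjoin_Con[OF alg Con(2) \<beta>] by blast
  have "centralizes F ar A \<alpha>' \<alpha> (\<alpha>' \<inter> \<alpha>)"
    by (rule centralizes_inter[OF Con(2,1) Int_Con[OF Con(2,1)]]) auto
  moreover have "\<alpha>' \<inter> \<alpha> \<subseteq> ?\<delta>" using compl(1) Delta_subset[OF \<delta>] by blast
  ultimately have "centralizes F ar A \<alpha>' \<alpha> ?\<delta>"
    using centralizes_mono[OF Con(2,1) Int_Con[OF Con(2,1)] \<delta>] by blast
  moreover have "centralizes F ar A \<beta> \<alpha> ?\<delta>"
    by (rule centralizes_inter[OF \<beta> Con(1) \<delta>]) auto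
  ultimately show ?thesis using centralizes_cover[OF Con(2) \<beta> Con(1) \<delta> _ _ cover] by blast
qed

section \<open>Radicals and the reticulation\<close>

lemma rho_le_iff:
  assumes "\<theta> \<in> Con F ar A"
  shows "rho F ar A \<theta> \<subseteq> rho F ar A \<psi> \<longleftrightarrow> DA F ar A \<theta> \<subseteq> DA F ar A \<psi>"
proof
  assume le: "rho F ar A \<theta> \<subseteq> rho F ar A \<psi>"
  have "\<theta> \<subseteq> rho F ar A \<theta>" using Con_subset[OF assms] by (auto simp: rho_def VA_def)
  then have "\<theta> \<subseteq> \<phi>" if "\<phi> \<in> VA F ar A \<psi>" for \<phi> using le that by (auto simp: rho_def)
  then show "DA F ar A \<theta> \<subseteq> DA F ar A \<psi>" by (auto simp: DA_def VA_def)
next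
  assume "DA F ar A \<theta> \<subseteq> DA F ar A \<psi>"
  then have "VA F ar A \<psi> \<subseteq> VA F ar A \<theta>" by (auto simp: DA_def VA_def)
  then show "rho F ar A \<theta> \<subseteq> rho F ar A \<psi>" by (auto simp: rho_def)
qed

lemma Kc_Con: "\<alpha> \<in> Kc F ar A \<Longrightarrow> \<alpha> \<in> Con F ar A"
  by (simp add: Kc_def)

lemma lam_self: "\<alpha> \<in> Kc F ar A \<Longrightarrow> \<alpha> \<in> lam F ar A \<alpha>"
  by (simp add: lam_def)

text \<open>All members of a class have the same radical, so the representatives chosen in
  \<open>ret_le\<close> do not matter.\<close>

lemma ret_le_lam_iff:
  assumes "\<alpha> \<in> Kc F ar A" "\<beta> \<in> Kc F ar A"
  shows "ret_le F ar A (lam F ar A \<alpha>) (lam F ar A \<beta>) \<longleftrightarrow> DA F ar A \<alpha> \<subseteq> DA F ar A \<beta>"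
  unfolding rho_le_iff[OF Kc_Con[OF assms(1)], symmetric] ret_le_def
  using lam_self[OF assms(1)] lam_self[OF assms(2)] by (fastforce simp: lam_def)

text \<open>The complement is the class of \<beta>: a class below both has empty \<open>D\<close>,
  like \<open>Delta A\<close>, and a class above both has \<open>D\<close> equal to the whole
  spectrum, like \<open>Nabla A\<close>.\<close>

lemma lam_BRet:
  assumes \<alpha>: "\<alpha> \<in> Kc F ar A" and \<beta>: "\<beta> \<in> Kc F ar A"
    and compl: "DA F ar A \<beta> = Spec F ar A - DA F ar A \<alpha>"
  shows "lam F ar A \<alpha> \<in> BRet F ar A"
  unfolding BRet_def
proof (intro CollectI conjI bexI[of _ "lam F ar A \<beta>"] ballI impI)
  note iff = ret_le_lam_iff
  fix z assume "z \<in> Ret F ar A"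
  then obtain \<gamma> where \<gamma>: "\<gamma> \<in> Kc F ar A" and z: "z = lam F ar A \<gamma>" by (auto simp: Ret_def)
  show "ret_le F ar A z (lam F ar A (Delta A))"
    if "ret_le F ar A z (lam F ar A \<alpha>) \<and> ret_le F ar A z (lam F ar A \<beta>)"
    using that compl unfolding z iff[OF \<gamma> \<alpha>] iff[OF \<gamma> \<beta>] iff[OF \<gamma> Delta_compact[OF alg]] by blast
  show "ret_le F ar A (lam F ar A (Nabla A)) z"
    if "ret_le F ar A (lam F ar A \<alpha>) z \<and> ret_le F ar A (lam F ar A \<beta>) z"
    using that compl DA_Nabla
    unfolding z iff[OF \<alpha> \<gamma>] iff[OF \<beta> \<gamma>] iff[OF Nabla_compact \<gamma>] by blast
qed (use \<alpha> \<beta> in \<open>auto simp: Ret_def\<close>)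

text \<open>If \<open>U\<close> and its complement are \<open>D(\<theta>)\<close> and
  \<open>D(\<chi>)\<close>, then \<theta> and \<chi> join to \<open>Nabla A\<close>. Finitely many
  pairs \<open>P\<close> of their union already generate it; the pairs from \<theta> and those from
  \<chi> generate the two compact congruences.\<close>

lemma Clop_compact_pair:
  assumes "U \<in> Clop F ar A"
  obtains \<alpha> \<beta> where "\<alpha> \<in> Kc F ar A" "\<beta> \<in> Kc F ar A" "DA F ar A \<alpha> = U" "DA F ar A \<beta> = Spec F ar A - U"
proof -
  obtain \<theta> \<chi> where Con: "\<theta> \<in> Con F ar A" "\<chi> \<in> Con F ar A"
    and U: "U = DA F ar A \<theta>" "Spec F ar A - U = DA F ar A \<chi>"
    using assms unfolding Clop_def spec_open_def by blast
  have sub: "\<theta> \<union> \<chi> \<subseteq> Nabla A" using Con[THEN Con_subset] by blast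
  have "DA F ar A (cjoin F ar A \<theta> \<chi>) = Spec F ar A"
    unfolding DA_cjoin U(1)[symmetric] U(2)[symmetric] using assms by (simp add: Clop_def Un_absorb1)
  then have top: "cg F ar A (\<theta> \<union> \<chi>) = Nabla A"
    using DA_eq_Spec_iff[OF cjoin_Con[OF alg Con]] by (simp add: cjoin_def)
  obtain G where G: "finite G" "G \<subseteq> Nabla A" "cg F ar A G = Nabla A"
    by (rule Nabla_finitely_generated)
  obtain P where P: "finite P" "P \<subseteq> \<theta> \<union> \<chi>" "G \<subseteq> cg F ar A P"
    using cg_finite_subset[OF alg sub G(1) G(2)[folded top]] .
  let ?\<alpha> = "cg F ar A (P \<inter> \<theta>)" and ?\<beta> = "cg F ar A (P \<inter> \<chi>)"
  have K: "?\<alpha> \<in> Kc F ar A" "?\<beta> \<in> Kc F ar A"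
    using P(1) sub by (auto intro!: cg_finite_compact[OF alg])
  have le: "?\<alpha> \<subseteq> \<theta>" "?\<beta> \<subseteq> \<chi>" by (rule cg_least[OF Con(1) Int_lower2], rule cg_least[OF Con(2) Int_lower2])
  have J: "cjoin F ar A ?\<alpha> ?\<beta> \<in> Con F ar A" by (rule cjoin_Con[OF alg K[THEN Kc_Con]])
  have "P \<subseteq> cjoin F ar A ?\<alpha> ?\<beta>"
    using P(2) subset_cg[of "P \<inter> \<theta>" F ar A] subset_cg[of "P \<inter> \<chi>" F ar A]
      subset_cg[of "?\<alpha> \<union> ?\<beta>" F ar A] unfolding cjoin_def by blast
  then have "Nabla A \<subseteq> cjoin F ar A ?\<alpha> ?\<beta>"
    unfolding G(3)[symmetric] by (intro cg_least[OF J] order_trans[OF P(3)])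
  then have "cjoin F ar A ?\<alpha> ?\<beta> = Nabla A" using Con_subset[OF J] by (intro equalityI)
  then have "DA F ar A ?\<alpha> \<union> DA F ar A ?\<beta> = Spec F ar A"
    using DA_cjoin[of ?\<alpha> ?\<beta>] DA_Nabla by simp
  moreover have "DA F ar A ?\<alpha> \<subseteq> U" "DA F ar A ?\<beta> \<subseteq> Spec F ar A - U"
    unfolding U(2) unfolding U(1) by (rule DA_mono[OF le(1)], rule DA_mono[OF le(2)])
  \<comment> \<open>The two sets lie in \<open>U\<close> and in its complement and cover the
    spectrum, so neither inclusion is proper.\<close>
  ultimately have "DA F ar A ?\<alpha> = U" "DA F ar A ?\<beta> = Spec F ar A - U"
    using assms by (auto simp: Clop_def)
  then show thesis by (rule that[OF K])
qed

lemma Clop_BCon: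
  assumes pres: "preserves_bc F ar A" and U: "U \<in> Clop F ar A"
  shows "U \<in> DA F ar A ` BCon F ar A"
proof -
  obtain \<alpha> \<beta> where \<alpha>: "\<alpha> \<in> Kc F ar A" and \<beta>: "\<beta> \<in> Kc F ar A"
    and DA: "DA F ar A \<alpha> = U" "DA F ar A \<beta> = Spec F ar A - U"
    by (rule Clop_compact_pair[OF U])
  have "lam F ar A \<alpha> \<in> BRet F ar A" using lam_BRet[OF \<alpha> \<beta>] DA by simp
  then obtain \<epsilon> where \<epsilon>: "\<epsilon> \<in> BCon F ar A" "lam F ar A \<alpha> = lam F ar A \<epsilon>"
    using pres unfolding preserves_bc_def by blast
  \<comment> \<open>\<alpha> is compact, so it lies in its own class, which is the class of
    \<epsilon>.\<close>
  then have "rho F ar A \<alpha> = rho F ar A \<epsilon>" using lam_self[OF \<alpha>] by (simp add: lam_def)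
  moreover have "\<epsilon> \<in> Con F ar A" using \<epsilon>(1) by (simp add: BCon_def)
  ultimately have "DA F ar A \<alpha> = DA F ar A \<epsilon>"
    using rho_le_iff[OF Kc_Con[OF \<alpha>], of \<epsilon>] rho_le_iff[of \<epsilon> \<alpha>] by auto
  then show ?thesis using \<epsilon>(1) DA(1) by blast
qed

lemma DA_bij:
  assumes "preserves_bc F ar A"
  shows "bij_betw (DA F ar A) (BCon F ar A) (Clop F ar A)"
proof (rule bij_betw_imageI)
  show "inj_on (DA F ar A) (BCon F ar A)"
  proof (rule inj_onI)
    fix \<alpha> \<beta> assume B: "\<alpha> \<in> BCon F ar A" "\<beta> \<in> BCon F ar A" and eq: "DA F ar A \<alpha> = DA F ar A \<beta>"
    have "\<alpha> \<in> Con F ar A" "\<beta> \<in> Con F ar A" using B by (simp_all add: BCon_def)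
    then show "\<alpha> = \<beta>" using BCon_DA_mono B eq by (metis order_refl subset_antisym)
  qed
  show "DA F ar A ` BCon F ar A = Clop F ar A" using DA_BCon_Clop Clop_BCon[OF assms] by blast
qed

end

theorem theorem4p9:
  fixes F :: "'f set" and ar :: "'f \<Rightarrow> nat" and Eq :: "('f trm \<times> 'f trm) set"
    and A :: "('a, 'f) alg"
  assumes fin: "finite F"
    and eqs: "eqns F ar Eq"
    and cm_nat: "cong_modular_on F ar Eq TYPE(nat)"
    and cm_a: "cong_modular_on F ar Eq TYPE('a)"
    and sd_nat: "semidegenerate_on F ar Eq TYPE(nat)"
    and sd_a: "semidegenerate_on F ar Eq TYPE('a)"
    and AV: "in_var F ar Eq A"
    and Kcomm: "\<forall>\<alpha>\<in>Kc F ar A. \<forall>\<beta>\<in>Kc F ar A. comm F ar A \<alpha> \<beta> \<in> Kc F ar A"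
    and pres: "preserves_bc F ar A"
  shows "(\<forall>\<alpha>\<in>BCon F ar A. DA F ar A \<alpha> \<in> Clop F ar A) \<and>
         bij_betw (DA F ar A) (BCon F ar A) (Clop F ar A) \<and>
         (\<forall>\<alpha>\<in>BCon F ar A. \<forall>\<beta>\<in>BCon F ar A.
            DA F ar A (cjoin F ar A \<alpha> \<beta>) = DA F ar A \<alpha> \<union> DA F ar A \<beta> \<and>
            DA F ar A (\<alpha> \<inter> \<beta>) = DA F ar A \<alpha> \<inter> DA F ar A \<beta>) \<and>
         DA F ar A (Delta A) = {} \<and>
         DA F ar A (Nabla A) = Spec F ar A \<and>
         (\<forall>\<alpha>\<in>BCon F ar A. \<forall>\<beta>\<in>Con F ar A.
            \<alpha> \<inter> \<beta> = Delta A \<and> cjoin F ar A \<alpha> \<beta> = Nabla A \<longrightarrow>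
            DA F ar A \<beta> = Spec F ar A - DA F ar A \<alpha>)"
proof -
  interpret sdcm_algebra F ar Eq A
    using fin eqs cm_nat cm_a sd_nat sd_a AV by unfold_locales
  have Con: "\<alpha> \<in> Con F ar A" if "\<alpha> \<in> BCon F ar A" for \<alpha> using that by (simp add: BCon_def)
  show ?thesis
    by (intro conjI ballI impI DA_BCon_Clop DA_bij[OF pres] DA_cjoin DA_inter DA_Delta DA_Nabla
        DA_complement) (simp_all add: Con)
qed

end
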